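(* Let $X\subset\mathbb{C}^{n}$ be a domain and let $L,M:X\times X\to\mathbb{C}$ be sesqui-holomorphic non-degenerate bi-functions on $X$. The following are equivalent: (i) $L$ and $M$ are Hermitean rescalings on $X$; (i$'$) $L$ and $M$ are Hermitean rescalings on some somewhere dense subset of $X$; (ii) There is a nonempty open set $U\subset X$ and a holomorphic function $f:U\to\mathbb{C}\setminus\{0\}$ such that $\widehat{M}=|f|^{2}\widehat{L}$ on $U$; (iii) There is a nonempty open set $U\subset X$ such that $\frac{\partial^{2}}{\partial z_{j}\partial\overline{z_{k}}}\log\widehat{L}=\frac{\partial^{2}}{\partial z_{j}\partial\overline{z_{k}}}\log\widehat{M}$ on $U$ for all $j,k\in\{1,\dots,n\}$, and $\frac{\widehat{M}}{\widehat{L}}>0$ on a somewhere dense set; (iv) There are $y,z\in X$ and a somewhere dense set $U\subset X$ such that $\frac{M(z,z)}{L(z,z)}>0$ and $$\frac{|L(x,y)|^{2}}{L(x,x)L(y,y)}=\frac{|M(x,y)|^{2}}{M(x,x)M(y,y)}\quad\text{for every }x\in U.$$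
   Context: A domain is an open connected set. A bi-function on $X$ is a function $X\times X\to\mathbb{C}$; it is sesqui-holomorphic if it is holomorphic in the first variable and anti-holomorphic in the second. The diagonal function of $L$ is $\widehat{L}(x)=L(x,x)$, $x\in X$; $L$ is non-degenerate if $\widehat{L}$ does not vanish on $X$. A set is somewhere dense if its closure has nonempty interior. For $Y\subset X$, $L$ and $M$ are Hermitean rescalings on $Y$ if there is $f:Y\to\mathbb{C}\setminus\{0\}$ with $M(x,y)=f(x)\overline{f(y)}L(x,y)$ for all $x,y\in Y$. The notation $\alpha>0$ for a complex number means it is real and positive. In (iii), $\log$ of a non-vanishing function is understood via local continuous branches; the second derivatives do not depend on the choice of branch. *)

theory Defs
  imports "HOL-Analysis.Analysis"
begin

text \<open>
  Bi-functions on a set \<open>X\<close> are represented by curried total functions; every notion below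
  only refers to their values at points of \<open>X\<close>.

  Positivity of a complex number \<open>\<alpha>\<close> is the library's \<open>0 < \<alpha>\<close> on type \<^typ>\<open>complex\<close>,
  which means \<open>Im \<alpha> = 0\<close> and \<open>0 < Re \<alpha>\<close>.
\<close>

text \<open>Holomorphy in several variables on an open set: Frechet differentiability with a
  complex-linear derivative. Intended for open \<open>U\<close> only.\<close>

definition holomorphic_several_on :: "(complex ^ 'n \<Rightarrow> complex) \<Rightarrow> (complex ^ 'n) set \<Rightarrow> bool"
  where "holomorphic_several_on f U \<longleftrightarrow>
    (\<forall>x\<in>U. \<exists>D. (f has_derivative D) (at x) \<and> (\<forall>c v. D (c *s v) = c * D v))"

definition antiholomorphic_several_on :: "(complex ^ 'n \<Rightarrow> complex) \<Rightarrow> (complex ^ 'n) set \<Rightarrow> bool"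
  where "antiholomorphic_several_on f U \<longleftrightarrow> holomorphic_several_on (\<lambda>x. cnj (f x)) U"

text \<open>Only separate holomorphy is demanded: no joint regularity in both variables.\<close>

definition sesqui_holomorphic_on ::
    "(complex ^ 'n \<Rightarrow> complex ^ 'n \<Rightarrow> complex) \<Rightarrow> (complex ^ 'n) set \<Rightarrow> bool"
  where "sesqui_holomorphic_on L X \<longleftrightarrow>
    (\<forall>y\<in>X. holomorphic_several_on (\<lambda>x. L x y) X) \<and>
    (\<forall>x\<in>X. antiholomorphic_several_on (\<lambda>y. L x y) X)"

definition diagonal :: "('a \<Rightarrow> 'a \<Rightarrow> complex) \<Rightarrow> 'a \<Rightarrow> complex"
  where "diagonal L x = L x x"

definition nondegenerate_on :: "('a \<Rightarrow> 'a \<Rightarrow> complex) \<Rightarrow> 'a set \<Rightarrow> bool"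
  where "nondegenerate_on L X \<longleftrightarrow> (\<forall>x\<in>X. diagonal L x \<noteq> 0)"

definition somewhere_dense :: "'a::topological_space set \<Rightarrow> bool"
  where "somewhere_dense S \<longleftrightarrow> interior (closure S) \<noteq> {}"

definition hermitean_rescalings_on ::
    "('a \<Rightarrow> 'a \<Rightarrow> complex) \<Rightarrow> ('a \<Rightarrow> 'a \<Rightarrow> complex) \<Rightarrow> 'a set \<Rightarrow> bool"
  where "hermitean_rescalings_on L M Y \<longleftrightarrow>
    (\<exists>f. (\<forall>x\<in>Y. f x \<noteq> 0) \<and> (\<forall>x\<in>Y. \<forall>y\<in>Y. M x y = f x * cnj (f y) * L x y))"

text \<open>The real partial derivative of \<open>g\<close> at \<open>x\<close> in the direction \<open>v\<close>; with \<open>v = axis j 1\<close> and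
  \<open>v = axis j \<i>\<close> these are the derivatives with respect to the real and the imaginary part
  of the \<open>j\<close>-th coordinate.\<close>

definition real_partial :: "complex ^ 'n \<Rightarrow> (complex ^ 'n \<Rightarrow> complex) \<Rightarrow> complex ^ 'n \<Rightarrow> complex"
  where "real_partial v g x = vector_derivative (\<lambda>t::real. g (x + t *\<^sub>R v)) (at 0)"

definition wirtinger :: "'n \<Rightarrow> (complex ^ 'n \<Rightarrow> complex) \<Rightarrow> complex ^ 'n \<Rightarrow> complex"
  where "wirtinger j g x =
    (real_partial (axis j 1) g x - \<i> * real_partial (axis j \<i>) g x) / 2"

definition wirtinger_bar :: "'n \<Rightarrow> (complex ^ 'n \<Rightarrow> complex) \<Rightarrow> complex ^ 'n \<Rightarrow> complex"
  where "wirtinger_bar j g x =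
    (real_partial (axis j 1) g x + \<i> * real_partial (axis j \<i>) g x) / 2"

text \<open>\<open>l\<close> is a continuous branch of \<open>log F\<close> in a neighbourhood of \<open>x\<close>. Two branches near
  \<open>x\<close> differ by a constant on a neighbourhood of \<open>x\<close>, so derivatives at \<open>x\<close> do not depend
  on the choice.\<close>

definition log_branch_near ::
    "'a::topological_space \<Rightarrow> ('a \<Rightarrow> complex) \<Rightarrow> ('a \<Rightarrow> complex) \<Rightarrow> bool"
  where "log_branch_near x F l \<longleftrightarrow>
    (\<exists>V. open V \<and> x \<in> V \<and> continuous_on V l \<and> (\<forall>v\<in>V. exp (l v) = F v))"

end

theory Submission
  imports Defs "HOL-Complex_Analysis.Conformal_Mappings"
begin

text \<open>
  Everything passes through one identity. Fix \<open>w\<close>; if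
  \<open>L x w * cnj (L y w) * (M x y * M w w) = M x w * cnj (M y w) * (L x y * L w w)\<close> on \<open>X \<times> X\<close>,
  then \<open>h = M _ w / L _ w\<close> is a rescaling up to the constant \<open>L w w / M w w\<close> wherever it is
  defined and non-zero, and it extends to all of \<open>X\<close> by comparing it with base points at which
  \<open>L\<close> does not vanish; one point with \<open>M z z / L z z > 0\<close> makes the constant positive. The identity
  is sesqui-holomorphic in \<open>(x, y)\<close>, so by polarization it only has to be checked on the diagonal
  over a somewhere dense set, where it is condition (iv). Hence (i) implies (i'), (i') implies (iv) and
  (iv) implies (i), while (ii) implies (i') by polarizing \<open>M x x = |f x|\<^sup>2 * L x x\<close>.

  Under (iii) the functions \<open>\<partial>\<^sub>k L / L\<close> and \<open>\<partial>\<^sub>k M / M\<close> (derivatives in the conjugated variable) have,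
  after polarization, the same derivatives in the first variable. Their difference is therefore
  independent of the first variable, so \<open>R = M / L\<close> satisfies \<open>R x x * R w w = R x w * R w x\<close>
  locally; positivity of \<open>R\<close> on a somewhere dense part of the diagonal gives
  \<open>R w x = cnj (R x w)\<close>, hence (iv).

  Only separate holomorphy is assumed, but Hartogs' theorem is avoided: all arguments start on an open
  set that may be shrunk, and Baire's theorem makes a bi-function bounded, hence jointly continuous,
  on some smaller \<open>V \<times> V\<close>.
\<close>

subsection \<open>Holomorphic functions of several variables\<close>

lemma norm_vector_scalar_mult: "norm (c *s v) = cmod c * norm (v :: complex ^ 'n)"
  by (simp add: norm_vec_def norm_mult L2_set_right_distrib)

lemma bounded_linear_vector_scalar_mult_left: "bounded_linear (\<lambda>c. c *s (v :: complex ^ 'n))"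
  by (rule bounded_linear_intro[where K = "norm v"])
     (auto simp: vec_eq_iff algebra_simps norm_vector_scalar_mult)

lemma continuous_on_vector_scalar_mult [continuous_intros]:
  fixes v :: "complex ^ 'n"
  assumes "continuous_on S f"
  shows "continuous_on S (\<lambda>t. f t *s v)"
  using bounded_linear.continuous_on[OF bounded_linear_vector_scalar_mult_left assms] .

lemma holomorphic_several_on_const: "holomorphic_several_on (\<lambda>x. k) U"
  unfolding holomorphic_several_on_def by (intro ballI exI[of _ "\<lambda>_. 0"]) auto

lemma holomorphic_several_on_mult:
  assumes "holomorphic_several_on f U" "holomorphic_several_on g U"
  shows "holomorphic_several_on (\<lambda>x. f x * g x) U"
  unfolding holomorphic_several_on_def
proof
  fix x assume x: "x \<in> U"
  obtain D E where D: "(f has_derivative D) (at x)" "\<forall>c v. D (c *s v) = c * D v"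
    and E: "(g has_derivative E) (at x)" "\<forall>c v. E (c *s v) = c * E v"
    using assms x unfolding holomorphic_several_on_def by meson
  show "\<exists>D. ((\<lambda>x. f x * g x) has_derivative D) (at x) \<and> (\<forall>c v. D (c *s v) = c * D v)"
    using has_derivative_mult[OF D(1) E(1)] D(2) E(2)
    by (intro exI[of _ "\<lambda>h. f x * E h + D h * g x"]) (auto simp: algebra_simps)
qed

lemma holomorphic_several_on_diff:
  assumes "holomorphic_several_on f U" "holomorphic_several_on g U"
  shows "holomorphic_several_on (\<lambda>x. f x - g x) U"
  unfolding holomorphic_several_on_def
proof
  fix x assume x: "x \<in> U"
  obtain D E where D: "(f has_derivative D) (at x)" "\<forall>c v. D (c *s v) = c * D v"
    and E: "(g has_derivative E) (at x)" "\<forall>c v. E (c *s v) = c * E v"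
    using assms x unfolding holomorphic_several_on_def by meson
  show "\<exists>D. ((\<lambda>x. f x - g x) has_derivative D) (at x) \<and> (\<forall>c v. D (c *s v) = c * D v)"
    using has_derivative_diff[OF D(1) E(1)] D(2) E(2)
    by (intro exI[of _ "\<lambda>h. D h - E h"]) (auto simp: algebra_simps)
qed

lemma holomorphic_several_on_inverse:
  assumes "holomorphic_several_on f U" and nz: "\<And>x. x \<in> U \<Longrightarrow> f x \<noteq> 0"
  shows "holomorphic_several_on (\<lambda>x. inverse (f x)) U"
  unfolding holomorphic_several_on_def
proof
  fix x assume x: "x \<in> U"
  obtain D where D: "(f has_derivative D) (at x)" "\<forall>c v. D (c *s v) = c * D v"
    using assms x unfolding holomorphic_several_on_def by meson
  show "\<exists>D. ((\<lambda>x. inverse (f x)) has_derivative D) (at x) \<and> (\<forall>c v. D (c *s v) = c * D v)"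
    using Deriv.has_derivative_inverse[OF nz[OF x] D(1)] D(2)
    by (intro exI[of _ "\<lambda>h. - (inverse (f x) * D h * inverse (f x))"]) (auto simp: algebra_simps)
qed

lemma holomorphic_several_on_subset:
  "holomorphic_several_on f U \<Longrightarrow> V \<subseteq> U \<Longrightarrow> holomorphic_several_on f V"
  unfolding holomorphic_several_on_def by blast

lemma holomorphic_several_on_cong:
  assumes "holomorphic_several_on f U" "open U" "\<And>x. x \<in> U \<Longrightarrow> f x = g x"
  shows "holomorphic_several_on g U"
  unfolding holomorphic_several_on_def
proof
  fix x assume x: "x \<in> U"
  obtain D where D: "(f has_derivative D) (at x)" "\<forall>c v. D (c *s v) = c * D v"
    using assms(1) x unfolding holomorphic_several_on_def by meson
  have "(g has_derivative D) (at x)"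
    by (rule has_derivative_transform_within_open[OF D(1) assms(2) x assms(3)])
  then show "\<exists>D. (g has_derivative D) (at x) \<and> (\<forall>c v. D (c *s v) = c * D v)"
    using D(2) by blast
qed

lemma holomorphic_several_on_imp_continuous_on:
  "holomorphic_several_on f U \<Longrightarrow> continuous_on U f"
  unfolding holomorphic_several_on_def
  by (meson continuous_at_imp_continuous_on has_derivative_continuous)

text \<open>Complex linearity turns the chain rule along \<open>t *s v\<close> into multiplication
  by \<open>D v\<close>. This is how one-variable complex analysis is brought to bear on several
  variables.\<close>

lemma holomorphic_several_on_line:
  assumes "holomorphic_several_on f U" "x + t *s v \<in> U"
  shows "(\<lambda>t. f (x + t *s v)) field_differentiable (at t)"
proof -
  obtain D where D: "(f has_derivative D) (at (x + t *s v))" "\<And>c v. D (c *s v) = c * D v"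
    using assms unfolding holomorphic_several_on_def by meson
  have "((\<lambda>t. x + t *s v) has_derivative (\<lambda>h. h *s v)) (at t)"
    using has_derivative_add[OF has_derivative_const
        bounded_linear_imp_has_derivative[OF bounded_linear_vector_scalar_mult_left]] by force
  from has_derivative_compose[OF this D(1)]
  have "((\<lambda>t. f (x + t *s v)) has_derivative (\<lambda>h. h * D v)) (at t)"
    by (simp add: D(2))
  then have "((\<lambda>t. f (x + t *s v)) has_derivative (*) (D v)) (at t)"
    by (simp add: mult.commute[of _ "D v"] ext)
  then show ?thesis
    unfolding field_differentiable_def has_field_derivative_def by blast
qed

lemma holomorphic_several_on_line_holomorphic:
  assumes "holomorphic_several_on f U" "\<And>t. t \<in> T \<Longrightarrow> x + t *s v \<in> U"
  shows "(\<lambda>t. f (x + t *s v)) holomorphic_on T"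
  using holomorphic_several_on_line[OF assms(1)] assms(2)
  by (meson field_differentiable_at_within holomorphic_on_def)

text \<open>Propagation from a point of the interior of the zero set along complex lines inside a ball.\<close>

lemma holomorphic_several_eq_0_ball:
  fixes f :: "complex ^ 'n \<Rightarrow> complex"
  assumes hol: "holomorphic_several_on f (ball a r)" and W: "open W" "p \<in> W" "p \<in> ball a r"
    and zero: "\<And>x. x \<in> W \<Longrightarrow> f x = 0" and q: "q \<in> ball a r"
  shows "f q = 0"
proof -
  define \<gamma> where "\<gamma> t = p + t *s (q - p)" for t
  have cont: "continuous_on UNIV \<gamma>" unfolding \<gamma>_def by (intro continuous_intros)
  define T where "T = \<gamma> -` ball a r"
  have "open T" unfolding T_def using cont by (simp add: open_vimage)
  have "convex T"
  proof (rule convexI)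
    fix s t u v assume *: "s \<in> T" "t \<in> T" "0 \<le> (u::real)" "0 \<le> v" "u + v = 1"
    have "\<gamma> (u *\<^sub>R s + v *\<^sub>R t) = u *\<^sub>R \<gamma> s + v *\<^sub>R \<gamma> t"
    proof -
      have "of_real u + of_real v = (1::complex)" using *(5) by (metis of_real_add of_real_1)
      then have "p $ i = u * p $ i + v * p $ i" for i
        by (metis distrib_right mult_1)
      then show ?thesis unfolding \<gamma>_def
        by (simp add: vec_eq_iff) (simp add: algebra_simps scaleR_conv_of_real)
    qed
    then show "u *\<^sub>R s + v *\<^sub>R t \<in> T"
      using * convexD[OF convex_ball] unfolding T_def by fastforce
  qed
  have hol': "(\<lambda>t. f (\<gamma> t)) holomorphic_on T"
    unfolding \<gamma>_def by (rule holomorphic_several_on_line_holomorphic[OF hol]) (simp add: T_def \<gamma>_def)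
  define Z where "Z = \<gamma> -` W \<inter> T"
  have "open Z" unfolding Z_def using cont W \<open>open T\<close> by (simp add: open_Int open_vimage)
  have "0 \<in> Z" using W unfolding Z_def T_def \<gamma>_def by simp
  have "f (\<gamma> 1) = 0"
  proof (rule analytic_continuation[OF hol' \<open>open T\<close> convex_connected[OF \<open>convex T\<close>]])
    show "Z \<subseteq> T" "0 \<in> T" using \<open>0 \<in> Z\<close> unfolding Z_def by auto
    show "0 islimpt Z" using \<open>open Z\<close> \<open>0 \<in> Z\<close> by (simp add: interior_limit_point interior_open)
    show "f (\<gamma> z) = 0" if "z \<in> Z" for z using that zero unfolding Z_def by auto
    show "1 \<in> T" using q unfolding T_def \<gamma>_def by simp
  qed
  then show ?thesis by (simp add: \<gamma>_def)
qed

text \<open>The interior \<open>Z\<close> of the zero set is clopen in \<open>X\<close>: a point of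
  \<open>X\<close> in the closure of \<open>Z\<close> has a ball inside \<open>X\<close> that meets
  \<open>Z\<close>, and the previous lemma spreads the zeros over that ball.\<close>

lemma holomorphic_several_eq_0:
  fixes f :: "complex ^ 'n \<Rightarrow> complex"
  assumes X: "open X" "connected X" and hol: "holomorphic_several_on f X"
    and W: "open W" "W \<noteq> {}" "W \<subseteq> X" and zero: "\<And>x. x \<in> W \<Longrightarrow> f x = 0" and q: "q \<in> X"
  shows "f q = 0"
proof -
  define Z where "Z = interior {x \<in> X. f x = 0}"
  have "Z \<subseteq> X" unfolding Z_def using interior_subset by blast
  have "W \<subseteq> Z" unfolding Z_def using W zero by (intro interior_maximal) auto
  have "openin (top_of_set X) Z"
    using \<open>Z \<subseteq> X\<close> by (simp add: Z_def openin_open_eq X(1))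
  moreover have "closedin (top_of_set X) Z"
  proof -
    have "x \<in> Z" if "x \<in> X" "x \<in> closure Z" for x
    proof -
      obtain r where r: "r > 0" "ball x r \<subseteq> X" using X(1) \<open>x \<in> X\<close> openE by blast
      obtain p where p: "p \<in> Z" "p \<in> ball x r"
        using \<open>x \<in> closure Z\<close> r(1) by (metis closure_approachable dist_commute mem_ball)
      have "f y = 0" if "y \<in> ball x r" for y
        by (rule holomorphic_several_eq_0_ball[OF holomorphic_several_on_subset[OF hol r(2)] _ p _ that])
           (use interior_subset in \<open>auto simp: Z_def\<close>)
      then have "ball x r \<subseteq> {x \<in> X. f x = 0}" using r by auto
      then show "x \<in> Z" unfolding Z_def using r(1) by (meson centre_in_ball interiorI open_ball)
    qed
    then show ?thesis
      using \<open>Z \<subseteq> X\<close> by (auto simp: closedin_closed intro!: exI[of _ "closure Z"] subsetD[OF closure_subset])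
  qed
  ultimately have "Z = X" using X(2) W(2) \<open>W \<subseteq> Z\<close> by (metis connected_clopen subset_empty)
  then show ?thesis using q interior_subset unfolding Z_def by blast
qed

text \<open>If \<open>f\<close> vanished on all of \<open>W\<close>, the identity theorem would
  force \<open>f p = 0\<close>; continuity makes the non-zero part of \<open>W\<close> open.\<close>

lemma holomorphic_several_nonzero_in_open:
  fixes f g :: "complex ^ 'n \<Rightarrow> complex"
  assumes X: "open X" "connected X" and hol: "holomorphic_several_on f X"
    and W: "open W" "W \<noteq> {}" "W \<subseteq> X" and "p \<in> X" "f p \<noteq> 0"
  shows "\<exists>V. open V \<and> V \<noteq> {} \<and> V \<subseteq> W \<and> (\<forall>x\<in>V. f x \<noteq> 0)"
proof -
  have "continuous_on W f"
    using holomorphic_several_on_imp_continuous_on[OF hol] W(3) continuous_on_subset by blast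
  then have "open {x \<in> W. f x \<noteq> 0}"
    using continuous_open_preimage[OF _ W(1) open_Compl[OF closed_singleton[of 0]], of f]
    by (simp add: vimage_def Int_def)
  moreover have "{x \<in> W. f x \<noteq> 0} \<noteq> {}"
    using holomorphic_several_eq_0[OF X hol W] assms by auto
  ultimately show ?thesis by (intro exI[of _ "{x \<in> W. f x \<noteq> 0}"]) auto
qed

section \<open>Closure properties and sections of sesqui-holomorphic bi-functions\<close>

lemma sesqui_holomorphic_on_mult:
  "sesqui_holomorphic_on F X \<Longrightarrow> sesqui_holomorphic_on G X \<Longrightarrow>
    sesqui_holomorphic_on (\<lambda>x y. F x y * G x y) X"
  unfolding sesqui_holomorphic_on_def antiholomorphic_several_on_def
  by (auto intro: holomorphic_several_on_mult)

lemma sesqui_holomorphic_on_diff: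
  "sesqui_holomorphic_on F X \<Longrightarrow> sesqui_holomorphic_on G X \<Longrightarrow>
    sesqui_holomorphic_on (\<lambda>x y. F x y - G x y) X"
  unfolding sesqui_holomorphic_on_def antiholomorphic_several_on_def
  by (auto intro: holomorphic_several_on_diff)

lemma sesqui_holomorphic_on_const: "sesqui_holomorphic_on (\<lambda>x y. k) X"
  unfolding sesqui_holomorphic_on_def antiholomorphic_several_on_def
  by (auto intro: holomorphic_several_on_const)

lemma sesqui_holomorphic_on_fst:
  "holomorphic_several_on f X \<Longrightarrow> sesqui_holomorphic_on (\<lambda>x y. f x) X"
  unfolding sesqui_holomorphic_on_def antiholomorphic_several_on_def
  by (auto intro: holomorphic_several_on_const)

lemma sesqui_holomorphic_on_cnj_snd:
  "holomorphic_several_on f X \<Longrightarrow> sesqui_holomorphic_on (\<lambda>x y. cnj (f y)) X"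
  unfolding sesqui_holomorphic_on_def antiholomorphic_several_on_def
  by (auto intro: holomorphic_several_on_const)

lemma sesqui_holomorphic_on_cnj_swap:
  "sesqui_holomorphic_on F X \<Longrightarrow> sesqui_holomorphic_on (\<lambda>x y. cnj (F y x)) X"
  unfolding sesqui_holomorphic_on_def antiholomorphic_several_on_def by auto

lemma sesqui_holomorphic_on_subset:
  "sesqui_holomorphic_on F X \<Longrightarrow> Y \<subseteq> X \<Longrightarrow> sesqui_holomorphic_on F Y"
  unfolding sesqui_holomorphic_on_def antiholomorphic_several_on_def
  by (meson holomorphic_several_on_subset subsetD)

lemma sesqui_holomorphic_on_holomorphic:
  "sesqui_holomorphic_on F X \<Longrightarrow> y \<in> X \<Longrightarrow> holomorphic_several_on (\<lambda>x. F x y) X"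
  unfolding sesqui_holomorphic_on_def by blast

lemma sesqui_holomorphic_on_cnj:
  "sesqui_holomorphic_on F X \<Longrightarrow> x \<in> X \<Longrightarrow> holomorphic_several_on (\<lambda>y. cnj (F x y)) X"
  unfolding sesqui_holomorphic_on_def antiholomorphic_several_on_def by blast

text \<open>The identity theorem twice: first in the conjugated second argument with the first one
  fixed in \<open>W\<close>, then in the first argument.\<close>

lemma sesqui_holomorphic_eq_0:
  fixes F :: "complex ^ 'n \<Rightarrow> complex ^ 'n \<Rightarrow> complex"
  assumes X: "open X" "connected X" and F: "sesqui_holomorphic_on F X"
    and W: "open W" "W \<noteq> {}" "W \<subseteq> X" and zero: "\<And>x y. x \<in> W \<Longrightarrow> y \<in> W \<Longrightarrow> F x y = 0"
    and "x \<in> X" "y \<in> X"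
  shows "F x y = 0"
proof -
  have "F x' y = 0" if "x' \<in> W" for x'
  proof -
    have "x' \<in> X" using that W by blast
    have "cnj (F x' y) = 0"
      by (rule holomorphic_several_eq_0[OF X sesqui_holomorphic_on_cnj[OF F \<open>x' \<in> X\<close>] W])
         (use zero that assms in auto)
    then show ?thesis by simp
  qed
  then show ?thesis
    using holomorphic_several_eq_0[OF X sesqui_holomorphic_on_holomorphic[OF F \<open>y \<in> X\<close>] W]
      \<open>x \<in> X\<close> by blast
qed

text \<open>The Schwarz lemma on the complex line through \<open>a\<close> and \<open>x\<close>. The
  Lipschitz constant depends only on \<open>N\<close> and \<open>d\<close>, so it is common to all
  sections of a bounded bi-function.\<close>

lemma holomorphic_several_dist_le:
  fixes f :: "complex ^ 'n \<Rightarrow> complex"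
  assumes hol: "holomorphic_several_on f (ball a d)" and d: "d > 0"
    and bd: "\<And>x. x \<in> ball a d \<Longrightarrow> cmod (f x) \<le> N" and x: "x \<in> ball a d"
  shows "cmod (f x - f a) \<le> (2 * N + 1) / d * dist x a"
proof (cases "x = a")
  case False
  define n where "n = norm (x - a)"
  have n: "n > 0" "n < d" using False x by (auto simp: n_def dist_norm norm_minus_commute)
  have "N \<ge> 0" using bd[OF x] norm_ge_zero order_trans by blast
  \<comment> \<open>The parameter \<open>n / d\<close> gives the point \<open>x\<close>, and the
    unit disc sweeps out the line inside the ball. The differences are bounded by
    \<open>2 * N\<close>; dividing by \<open>2 * N + 1\<close> makes the bound strict and the
    divisor non-zero even if \<open>N = 0\<close>.\<close>
  define g where "g s = (f (a + s *s (of_real (d/n) *s (x - a))) - f a) / of_real (2 * N + 1)" for s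
  have in_ball: "a + s *s (of_real (d/n) *s (x - a)) \<in> ball a d" if "cmod s < 1" for s
  proof -
    have "norm (s *s (of_real (d/n) *s (x - a))) = cmod s * d"
      using n d unfolding norm_vector_scalar_mult by (simp add: norm_divide flip: n_def)
    also have "\<dots> < d" using that d by simp
    finally show ?thesis by (metis add_diff_cancel_left' dist_norm dist_commute mem_ball)
  qed
  have "(\<lambda>s. f (a + s *s (of_real (d/n) *s (x - a)))) holomorphic_on ball 0 1"
    by (rule holomorphic_several_on_line_holomorphic[OF hol]) (use in_ball in auto)
  then have hol_g: "g holomorphic_on ball 0 1" unfolding g_def
    using \<open>N \<ge> 0\<close> by (intro holomorphic_intros) (auto simp: complex_eq_iff)
  have g_less: "cmod (g s) < 1" if "cmod s < 1" for s
  proof -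
    have "cmod (f (a + s *s (of_real (d/n) *s (x - a))) - f a) \<le> N + N"
      by (rule order_trans[OF norm_triangle_ineq4 add_mono]) (use bd in_ball[OF that] d in auto)
    also have "\<dots> < 2 * N + 1" by simp
    finally show ?thesis using \<open>N \<ge> 0\<close> unfolding g_def norm_divide norm_of_real by simp
  qed
  have less: "cmod (of_real (n / d)) < 1" using n d unfolding norm_of_real by simp
  have "g 0 = 0" by (simp add: g_def)
  have "cmod (g (of_real (n/d))) \<le> cmod (of_real (n/d))"
    by (rule Schwarz_Lemma(1)[OF hol_g \<open>g 0 = 0\<close> g_less less])
  moreover have "a + of_real (n/d) *s (of_real (d/n) *s (x - a)) = x"
    using n d by (simp add: vec_eq_iff)
  ultimately have "cmod (f x - f a) / (2 * N + 1) \<le> n / d"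
    using \<open>N \<ge> 0\<close> n d by (simp add: g_def norm_divide del: of_real_add of_real_mult of_real_divide)
  then have "cmod (f x - f a) \<le> n / d * (2 * N + 1)"
    using \<open>N \<ge> 0\<close> by (simp add: pos_divide_le_eq)
  then show ?thesis by (simp add: n_def dist_norm mult.commute)
qed auto

subsection \<open>Joint continuity on a smaller open set\<close>

text \<open>Baire's theorem: the sets \<open>E n\<close> of those \<open>y\<close> whose section
  over a closed ball is bounded by \<open>n\<close> are closed and cover that ball, so one of them
  has an interior point.\<close>

lemma sesqui_holomorphic_locally_bounded:
  fixes F :: "complex ^ 'n \<Rightarrow> complex ^ 'n \<Rightarrow> complex"
  assumes F: "sesqui_holomorphic_on F X" and W: "open W" "W \<noteq> {}" "W \<subseteq> X"
  shows "\<exists>V N. open V \<and> V \<noteq> {} \<and> V \<subseteq> W \<and> (\<forall>x\<in>V. \<forall>y\<in>V. cmod (F x y) \<le> N)"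
proof -
  obtain p R where R: "R > 0" "cball p R \<subseteq> W"
    using W(1,2) by (metis all_not_in_conv open_contains_cball)
  define K where "K = cball p R"
  have K: "compact K" "closed K" "p \<in> K" "K \<subseteq> W" using R by (auto simp: K_def)
  have cont1: "continuous_on K (\<lambda>x. F x y)" if "y \<in> K" for y
    using holomorphic_several_on_imp_continuous_on[OF sesqui_holomorphic_on_holomorphic[OF F]]
      that K W by (meson continuous_on_subset subset_trans subsetD)
  have cont2: "continuous_on K (\<lambda>y. cmod (F x y))" if "x \<in> K" for x
  proof -
    have "continuous_on K (\<lambda>y. cmod (cnj (F x y)))"
      using holomorphic_several_on_imp_continuous_on[OF sesqui_holomorphic_on_cnj[OF F]]
        that K W by (intro continuous_on_norm) (meson continuous_on_subset subset_trans subsetD)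
    then show ?thesis by simp
  qed
  define E where "E n = {y \<in> K. \<forall>x\<in>K. cmod (F x y) \<le> real n}" for n
  have "E n = (\<Inter>x\<in>K. {y \<in> K. cmod (F x y) \<le> real n})" for n
    using K(3) unfolding E_def by blast
  then have clE: "closed (E n)" for n
    using cont2 K(2) by (auto intro!: closed_INT continuous_on_closed_Collect_le continuous_on_const)
  have cover: "\<exists>n. y \<in> E n" if y: "y \<in> K" for y
  proof -
    have "bounded ((\<lambda>x. F x y) ` K)"
      using compact_continuous_image[OF cont1[OF y] K(1)] compact_imp_bounded by blast
    then obtain B where "\<forall>x\<in>K. cmod (F x y) \<le> B" unfolding bounded_iff by blast
    then have "y \<in> E (nat \<lceil>B\<rceil>)" using y unfolding E_def
      by (auto intro: order_trans[OF _ real_nat_ceiling_ge])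
    then show ?thesis ..
  qed
  have "\<exists>n. interior (E n) \<noteq> {}"
  proof (rule ccontr)
    assume "\<not> ?thesis"
    then have empty: "interior (E n) = {}" for n by blast
    \<comment> \<open>With empty interiors the complements \<open>K - E n\<close> would be open and
      dense in \<open>K\<close>, so their intersection would be dense as well; but it is empty
      because the \<open>E n\<close> cover \<open>K\<close>.\<close>
    have "K \<subseteq> closure (\<Inter>(range (\<lambda>n. K - E n)))"
    proof (rule Baire[OF K(2)])
      fix T assume "T \<in> range (\<lambda>n. K - E n)"
      then obtain n where T: "T = K - E n" by blast
      \<comment> \<open>Density is shown on the open ball first, where a relatively open part of
        \<open>E n\<close> is open in the whole space; \<open>K\<close> is the closure of that
        ball.\<close>
      have "ball p R \<subseteq> closure T"
      proof
        fix y assume "y \<in> ball p R"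
        show "y \<in> closure T"
        proof (rule ccontr)
          assume "y \<notin> closure T"
          have "ball p R - closure T \<subseteq> E n"
            using closure_subset[of T] ball_subset_cball[of p R] unfolding T K_def by blast
          then have "ball p R - closure T \<subseteq> interior (E n)" by (simp add: interior_maximal open_Diff)
          then show False using \<open>y \<notin> closure T\<close> \<open>y \<in> ball p R\<close> empty by blast
        qed
      qed
      then have "K \<subseteq> closure T"
        using R(1) unfolding K_def by (metis closure_ball closure_minimal closed_closure)
      moreover have "openin (top_of_set K) T"
        unfolding T openin_open using clE[of n] by (intro exI[of _ "- E n"]) auto
      ultimately show "openin (top_of_set K) T \<and> K \<subseteq> closure T" by blast
    qed auto
    moreover have "\<Inter>(range (\<lambda>n. K - E n)) = {}" using cover by blast
    ultimately have "K \<subseteq> closure {}" by (simp only:)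
    then show False using K(3) by simp
  qed
  then obtain n where n: "interior (E n) \<noteq> {}" by blast
  have "interior (E n) \<subseteq> E n" by (rule interior_subset)
  \<comment> \<open>Points of \<open>interior (E n)\<close> also lie in \<open>K\<close>, so the
    bound over \<open>x \<in> K\<close> covers both arguments.\<close>
  then show ?thesis using n K unfolding E_def
    by (intro exI[of _ "interior (E n)"] exI[of _ "real n"]) (auto simp: E_def)
qed

text \<open>Boundedness makes \<open>F\<close> Lipschitz in the first argument uniformly in the
  second; together with continuity of the single section \<open>F a\<close> this gives continuity at
  \<open>(a, b)\<close>.\<close>

lemma sesqui_holomorphic_locally_continuous:
  fixes F :: "complex ^ 'n \<Rightarrow> complex ^ 'n \<Rightarrow> complex"
  assumes F: "sesqui_holomorphic_on F X" and W: "open W" "W \<noteq> {}" "W \<subseteq> X"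
  shows "\<exists>V. open V \<and> V \<noteq> {} \<and> V \<subseteq> W \<and> continuous_on (V \<times> V) (\<lambda>(x, y). F x y)"
proof -
  obtain V N where V: "open V" "V \<noteq> {}" "V \<subseteq> W" and N: "\<And>x y. x \<in> V \<Longrightarrow> y \<in> V \<Longrightarrow> cmod (F x y) \<le> N"
    using sesqui_holomorphic_locally_bounded[OF F W] by blast
  have FV: "sesqui_holomorphic_on F V" using sesqui_holomorphic_on_subset[OF F] V W by blast
  have "N \<ge> 0" using N V(2) by (meson ex_in_conv norm_ge_zero order_trans)
  have "continuous_on (V \<times> V) (\<lambda>(x, y). F x y)"
    unfolding continuous_on_iff
  proof (intro ballI allI impI)
    fix q and e :: real assume "q \<in> V \<times> V" and e: "e > 0"
    then obtain a b where q: "q = (a, b)" and ab: "a \<in> V" "b \<in> V" by blast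
    obtain d0 where d0: "d0 > 0" "ball a d0 \<subseteq> V" using V(1) ab(1) openE by blast
    define C where "C = (2 * N + 1) / d0"
    have C: "C > 0" using d0 \<open>N \<ge> 0\<close> by (simp add: C_def)
    have lip: "cmod (F x y - F a y) \<le> C * dist x a" if "y \<in> V" "x \<in> ball a d0" for x y
      unfolding C_def
      by (rule holomorphic_several_dist_le[OF holomorphic_several_on_subset[OF
            sesqui_holomorphic_on_holomorphic[OF FV \<open>y \<in> V\<close>] d0(2)] d0(1) _ that(2)])
         (use N d0(2) that in auto)
    have "continuous_on V (\<lambda>y. cnj (cnj (F a y)))"
      by (intro continuous_on_cnj holomorphic_several_on_imp_continuous_on
          sesqui_holomorphic_on_cnj[OF FV ab(1)])
    then obtain d1 where d1: "d1 > 0" "\<And>y. y \<in> V \<Longrightarrow> dist y b < d1 \<Longrightarrow> dist (F a y) (F a b) < e / 2"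
      using ab(2) e unfolding continuous_on_iff by (metis complex_cnj_cnj half_gt_zero)
    show "\<exists>d>0. \<forall>p\<in>V \<times> V. dist p q < d \<longrightarrow>
             dist (case p of (x, y) \<Rightarrow> F x y) (case q of (x, y) \<Rightarrow> F x y) < e"
    proof (intro exI[of _ "min d0 (min d1 (e / (2 * C)))"] conjI ballI impI)
      show "0 < min d0 (min d1 (e / (2 * C)))" using d0 d1 e C by simp
      fix p assume p: "p \<in> V \<times> V" and dp: "dist p q < min d0 (min d1 (e / (2 * C)))"
      obtain x y where xy: "p = (x, y)" by fastforce
      have dx: "dist x a \<le> dist p q" "dist y b \<le> dist p q"
        using dist_fst_le[of p "(a, b)"] dist_snd_le[of p "(a, b)"] by (auto simp: xy q)
      have "cmod (F x y - F a y) \<le> C * dist x a"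
        using lip[of y x] p dp dx by (auto simp: xy dist_commute[of x a])
      also have "\<dots> < e / 2" using dx(1) dp C by (simp add: field_simps) (smt (verit) mult_left_mono)
      finally have "dist (F x y) (F a y) < e / 2" by (simp add: dist_norm)
      moreover have "dist (F a y) (F a b) < e / 2" using d1(2) p dp dx by (auto simp: xy)
      ultimately show "dist (case p of (x, y) \<Rightarrow> F x y) (case q of (x, y) \<Rightarrow> F x y) < e"
        using dist_triangle[of "F x y" "F a b" "F a y"] by (simp add: xy q)
    qed
  qed
  then show ?thesis using V by blast
qed

subsection \<open>Continuous functions that are holomorphic in each coordinate\<close>

text \<open>By Osgood's lemma these are exactly the holomorphic functions on an open set.\<close>

definition osgood_holomorphic_on :: "(complex ^ 'm \<Rightarrow> complex) \<Rightarrow> (complex ^ 'm) set \<Rightarrow> bool"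
  where "osgood_holomorphic_on G \<Omega> \<longleftrightarrow>
    continuous_on \<Omega> G \<and> (\<forall>z\<in>\<Omega>. \<forall>i. (\<lambda>t. G (z + axis i t)) field_differentiable (at 0))"

definition partial_deriv :: "'m \<Rightarrow> (complex ^ 'm \<Rightarrow> complex) \<Rightarrow> complex ^ 'm \<Rightarrow> complex"
  where "partial_deriv i G z = deriv (\<lambda>t. G (z + axis i t)) 0"

lemma axis_add: "axis i (s + t) = axis i s + axis i (t :: 'a :: monoid_add)"
  by (simp add: vec_eq_iff axis_def)

lemma axis_0 [simp]: "axis i 0 = 0"
  by (simp add: vec_eq_iff axis_def)

lemma norm_axis [simp]: "norm (axis i u :: complex ^ 'm) = cmod u"
proof -
  have "(\<Sum>j\<in>UNIV. (cmod ((axis i u :: complex ^ 'm) $ j))\<^sup>2) = (\<Sum>j\<in>UNIV. if j = i then (cmod u)\<^sup>2 else 0)"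
    by (intro sum.cong) (auto simp: axis_def)
  then show ?thesis by (simp add: norm_vec_def L2_set_def)
qed

lemma continuous_on_axis [continuous_intros]:
  assumes "continuous_on S f"
  shows "continuous_on S (\<lambda>t. axis i (f t :: complex) :: complex ^ 'm)"
proof -
  have "(\<lambda>t. axis i (f t)) = (\<lambda>t. f t *s (axis i 1 :: complex ^ 'm))"
    by (intro ext) (simp add: vec_eq_iff axis_def)
  then show ?thesis using continuous_on_vector_scalar_mult[OF assms] by (simp only:)
qed

text \<open>The definition speaks about the parameter 0 only; moving the base point along the axis
  reaches every \<open>t\<close>.\<close>

lemma osgood_holomorphic_on_line:
  assumes "osgood_holomorphic_on G \<Omega>" "z + axis i t \<in> \<Omega>"
  shows "((\<lambda>t. G (z + axis i t)) has_field_derivative partial_deriv i G (z + axis i t)) (at t)"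
proof -
  have "((\<lambda>s. G (z + axis i t + axis i s)) has_field_derivative partial_deriv i G (z + axis i t)) (at 0)"
    using assms unfolding osgood_holomorphic_on_def partial_deriv_def
    by (meson DERIV_deriv_iff_field_differentiable)
  then show ?thesis
    using DERIV_shift[of "\<lambda>t. G (z + axis i t)" _ 0 t] by (simp add: axis_add add_ac)
qed

lemma osgood_holomorphic_on_diff:
  "osgood_holomorphic_on F \<Omega> \<Longrightarrow> osgood_holomorphic_on G \<Omega> \<Longrightarrow>
    osgood_holomorphic_on (\<lambda>z. F z - G z) \<Omega>"
  unfolding osgood_holomorphic_on_def
  by (auto intro!: continuous_intros field_differentiable_diff)

lemma osgood_holomorphic_on_divide:
  "osgood_holomorphic_on F \<Omega> \<Longrightarrow> osgood_holomorphic_on G \<Omega> \<Longrightarrow> (\<And>z. z \<in> \<Omega> \<Longrightarrow> G z \<noteq> 0) \<Longrightarrow>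
    osgood_holomorphic_on (\<lambda>z. F z / G z) \<Omega>"
  unfolding osgood_holomorphic_on_def
  by (auto intro!: continuous_intros field_differentiable_divide)

section \<open>Cauchy's formula for partial derivatives\<close>

definition circle_point :: "real \<Rightarrow> real \<Rightarrow> complex"
  where "circle_point r t = of_real r * exp (2 * of_real pi * \<i> * of_real t)"

lemma circle_point: "r > 0 \<Longrightarrow> circle_point r t \<noteq> 0" "r > 0 \<Longrightarrow> cmod (circle_point r t) = r"
  by (auto simp: circle_point_def norm_mult norm_exp)

lemma continuous_on_circle_point [continuous_intros]:
  "continuous_on S f \<Longrightarrow> continuous_on S (\<lambda>x. circle_point r (f x))"
  unfolding circle_point_def by (intro continuous_intros)

text \<open>Cauchy's formula for the first derivative: the velocity
  \<open>2 * pi * \<i> * circle_point r t\<close> cancels the prefactor and one of the two powers in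
  the denominator. The derivative becomes a parameter integral of \<open>G\<close> itself.\<close>

lemma partial_deriv_eq_integral:
  assumes G: "osgood_holomorphic_on G \<Omega>" and r: "r > 0"
    and sub: "\<And>u. cmod u \<le> r \<Longrightarrow> z + axis i u \<in> \<Omega>"
  shows "partial_deriv i G z =
    integral (cbox 0 1) (\<lambda>t. G (z + axis i (circle_point r t)) / circle_point r t)"
proof -
  let ?g = "\<lambda>u. G (z + axis i u)"
  have der: "(?g has_field_derivative partial_deriv i G (z + axis i u)) (at u)" if "cmod u \<le> r" for u
    using osgood_holomorphic_on_line[OF G] sub[OF that] by blast
  have hol: "?g holomorphic_on cball 0 r"
    unfolding holomorphic_on_def field_differentiable_def
    using der by (meson has_field_derivative_at_within mem_cball_0)
  have "(?g has_field_derivative (1 / (2 * of_real pi * \<i>) *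
      contour_integral (circlepath 0 r) (\<lambda>u. ?g u / (u - 0)\<^sup>2))) (at 0)"
    by (rule Cauchy_derivative_integral_circlepath(2))
       (use hol r in \<open>auto intro: holomorphic_on_imp_continuous_on holomorphic_on_subset\<close>)
  then have "partial_deriv i G z = 1 / (2 * of_real pi * \<i>) *
      contour_integral (circlepath 0 r) (\<lambda>u. ?g u / u\<^sup>2)"
    using der[of 0] r by (auto dest: DERIV_unique)
  also have "contour_integral (circlepath 0 r) (\<lambda>u. ?g u / u\<^sup>2) =
      integral (cbox 0 1) (\<lambda>t. 2 * of_real pi * \<i> * (?g (circle_point r t) / circle_point r t))"
  proof -
    have cp: "circlepath 0 r = circle_point r"
      by (simp add: circlepath circle_point_def fun_eq_iff)
    have "vector_derivative (circle_point r) (at t) = 2 * of_real pi * \<i> * circle_point r t" for t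
      using vector_derivative_circlepath[of 0 r t] unfolding cp by (simp add: circle_point_def)
    then show ?thesis
      unfolding contour_integral_integral cp cbox_interval
      by (intro arg_cong2[where f = integral] ext) (auto simp: power2_eq_square circle_point(1)[OF r])
  qed
  also have "\<dots> = 2 * of_real pi * \<i> * integral (cbox 0 1) (\<lambda>t. ?g (circle_point r t) / circle_point r t)"
    by (rule integral_mult_right)
  also have "1 / (2 * of_real pi * \<i>) * \<dots> =
      integral (cbox 0 1) (\<lambda>t. ?g (circle_point r t) / circle_point r t)"
    by simp
  finally show ?thesis .
qed

text \<open>Half the radius of a ball in \<open>\<Omega>\<close>, so that one circle radius serves
  all base points near \<open>z\<close>, as a parameter integral requires.\<close>

lemma open_axis_neighbourhood:
  assumes "open \<Omega>" "z \<in> (\<Omega> :: (complex ^ 'm) set)"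
  obtains r where "r > 0" "\<And>u x. x \<in> ball z r \<Longrightarrow> cmod u \<le> r \<Longrightarrow> x + axis i u \<in> \<Omega>"
proof -
  obtain e where e: "e > 0" "ball z e \<subseteq> \<Omega>" using assms openE by blast
  show thesis
  proof
    show "e / 2 > 0" using e by simp
    fix u x assume "x \<in> ball z (e / 2)" "cmod u \<le> e / 2"
    then have "dist z x < e / 2" "dist x (x + axis i u) \<le> e / 2"
      by (auto simp: dist_norm)
    then have "dist z (x + axis i u) < e" using dist_triangle[of z "x + axis i u" x] by simp
    then show "x + axis i u \<in> \<Omega>" using e by auto
  qed
qed

lemma continuous_on_partial_deriv:
  assumes "open \<Omega>" and G: "osgood_holomorphic_on G \<Omega>"
  shows "continuous_on \<Omega> (partial_deriv i G)"
proof (rule continuous_at_imp_continuous_on, rule)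
  fix z assume "z \<in> \<Omega>"
  obtain r where r: "r > 0" "\<And>u x. x \<in> ball z r \<Longrightarrow> cmod u \<le> r \<Longrightarrow> x + axis i u \<in> \<Omega>"
    using open_axis_neighbourhood[OF assms(1) \<open>z \<in> \<Omega>\<close>] by metis
  have cont: "continuous_on \<Omega> G" using G unfolding osgood_holomorphic_on_def by blast
  have "continuous_on (ball z r) (\<lambda>x. integral (cbox 0 1)
      (\<lambda>t. G (x + axis i (circle_point r t)) / circle_point r t))"
    using circle_point[OF r(1)] r(2) unfolding split_def
    by (intro integral_continuous_on_param) (auto simp: split_def intro!: continuous_intros
        continuous_on_compose2[OF cont])
  then have "continuous_on (ball z r) (partial_deriv i G)"
    by (rule continuous_on_eq) (use partial_deriv_eq_integral[OF G r(1)] r(2) in auto)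
  then show "isCont (partial_deriv i G) z"
    using r(1) by (simp add: continuous_on_eq_continuous_at)
qed

text \<open>Cauchy's formula may be differentiated under the integral sign along any axis
  \<open>k\<close>, since \<open>partial_deriv k G\<close> is continuous by the preceding lemma.
  Hence partial derivatives can be iterated.\<close>

lemma osgood_holomorphic_on_partial_deriv:
  assumes "open \<Omega>" and G: "osgood_holomorphic_on G \<Omega>"
  shows "osgood_holomorphic_on (partial_deriv i G) \<Omega>"
  unfolding osgood_holomorphic_on_def
proof (intro conjI ballI allI)
  show "continuous_on \<Omega> (partial_deriv i G)" by (rule continuous_on_partial_deriv[OF assms])
  fix z k assume "z \<in> \<Omega>"
  obtain r where r: "r > 0" "\<And>u x. x \<in> ball z r \<Longrightarrow> cmod u \<le> r \<Longrightarrow> x + axis i u \<in> \<Omega>"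
    using open_axis_neighbourhood[OF assms(1) \<open>z \<in> \<Omega>\<close>] by metis
  have cont: "continuous_on \<Omega> G" using G unfolding osgood_holomorphic_on_def by blast
  have in_ball: "z + axis k b \<in> ball z r" if "b \<in> ball 0 r" for b
    using that by (simp add: dist_norm)
  let ?c = "circle_point r"
  have "(\<lambda>b. integral (cbox 0 1) (\<lambda>t. G (z + axis k b + axis i (?c t)) / ?c t))
      holomorphic_on ball 0 r"
  proof (rule leibniz_rule_holomorphic)
    fix b :: complex and t :: real assume b: "b \<in> ball 0 r"
    have "z + axis i (?c t) + axis k b \<in> \<Omega>"
      using r(2)[OF in_ball[OF b], of "?c t"] circle_point(2)[OF r(1)] by (simp add: add_ac)
    from osgood_holomorphic_on_line[OF G this]
    have "((\<lambda>b. G (z + axis k b + axis i (?c t)) / ?c t) has_field_derivative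
        partial_deriv k G (z + axis k b + axis i (?c t)) / ?c t) (at b)"
      by (intro DERIV_cdivide) (simp add: add_ac)
    then show "((\<lambda>b. G (z + axis k b + axis i (?c t)) / ?c t) has_field_derivative
        partial_deriv k G (z + axis k b + axis i (?c t)) / ?c t) (at b within ball 0 r)"
      by (rule has_field_derivative_at_within)
  next
    fix b :: complex assume b: "b \<in> ball 0 r"
    show "(\<lambda>t. G (z + axis k b + axis i (?c t)) / ?c t) integrable_on cbox 0 1"
      using circle_point[OF r(1)] r(2)[OF in_ball[OF b]]
      by (intro integrable_continuous continuous_intros continuous_on_compose2[OF cont]) auto
  next
    show "continuous_on (ball 0 r \<times> cbox 0 1)
        (\<lambda>(b, t). partial_deriv k G (z + axis k b + axis i (?c t)) / ?c t)"
      using circle_point[OF r(1)] r(2)[OF in_ball] unfolding split_def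
      by (intro continuous_intros continuous_on_compose2[OF continuous_on_partial_deriv[OF assms]]) auto
  qed auto
  then have "(\<lambda>b. integral (cbox 0 1) (\<lambda>t. G (z + axis k b + axis i (?c t)) / ?c t))
      field_differentiable at 0"
    using r(1) by (simp add: holomorphic_on_open field_differentiable_def)
  moreover have ev: "\<forall>\<^sub>F b in nhds 0. partial_deriv i G (z + axis k b) =
      integral (cbox 0 1) (\<lambda>t. G (z + axis k b + axis i (?c t)) / ?c t)"
  proof (rule eventually_mono)
    show "\<forall>\<^sub>F b in nhds 0. b \<in> ball 0 r"
      using r(1) by (intro eventually_nhds_in_open) auto
  qed (rule partial_deriv_eq_integral[OF G r(1) r(2)[OF in_ball]])
  ultimately show "(\<lambda>b. partial_deriv i G (z + axis k b)) field_differentiable at 0"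
    unfolding field_differentiable_def DERIV_cong_ev[OF refl ev refl] by blast
qed

subsection \<open>Polarization\<close>

text \<open>The chain rule along a real line that moves two coordinates at once. It is used with
  \<open>d = cnj c\<close>, which keeps a point on the set where one coordinate is the conjugate of
  the other.\<close>

lemma osgood_holomorphic_on_two_axes:
  assumes "open \<Omega>" and H: "osgood_holomorphic_on H \<Omega>" and z: "z \<in> \<Omega>"
  shows "((\<lambda>t::real. H (z + axis i (of_real t * c) + axis k (of_real t * d))) has_vector_derivative
           c * partial_deriv i H z + d * partial_deriv k H z) (at 0)"
proof -
  obtain r where r: "r > 0" "\<And>u x. x \<in> ball z r \<Longrightarrow> cmod u \<le> r \<Longrightarrow> x + axis k u \<in> \<Omega>"
    using open_axis_neighbourhood[OF assms(1) z] by metis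
  define B where "B = ball (0::complex) r"
  have in_\<Omega>: "z + axis i a + axis k b \<in> \<Omega>" if "a \<in> B" "b \<in> B" for a b
    using r(2)[of "z + axis i a" b] that by (simp add: B_def dist_norm)
  let ?f = "\<lambda>a b. H (z + axis i a + axis k b)"
  let ?D = "\<lambda>a b. partial_deriv k H (z + axis i a + axis k b)"
  have "((\<lambda>(a, b). ?f a b) has_derivative
      (\<lambda>(s, t). partial_deriv i H z * s + blinfun_mult_right (?D 0 0) t)) (at (0, 0) within B \<times> B)"
  \<comment> \<open>Joint differentiability from the two partial derivatives, of which the second is
    continuous; it is wrapped as a bounded linear map because continuity is asked for in operator
    norm.\<close>
  proof (rule has_derivative_partialsI[where fy = "\<lambda>a b. blinfun_mult_right (?D a b)"])
    show "((\<lambda>a. ?f a 0) has_derivative (*) (partial_deriv i H z)) (at 0 within B)"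
      using osgood_holomorphic_on_line[OF H, of z i 0] z
      by (simp add: has_field_derivative_def has_derivative_at_withinI)
    fix a b assume "a \<in> B" "b \<in> B"
    then show "((\<lambda>b. ?f a b) has_derivative blinfun_apply (blinfun_mult_right (?D a b))) (at b within B)"
      using osgood_holomorphic_on_line[OF H, of "z + axis i a" k b] in_\<Omega>
      by (simp add: has_field_derivative_def has_derivative_at_withinI)
  next
    have "continuous_on (B \<times> B) (\<lambda>p. ?D (fst p) (snd p))"
      using in_\<Omega> by (intro continuous_on_compose2[OF continuous_on_partial_deriv[OF assms(1) H]]
          continuous_intros) auto
    then have "continuous_on (B \<times> B) (\<lambda>p. blinfun_mult_right (?D (fst p) (snd p)))"
      by (rule bounded_linear.continuous_on[OF bounded_linear_blinfun_mult_right])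
    then show "continuous (at (0, 0) within B \<times> B) (\<lambda>(a, b). blinfun_mult_right (?D a b))"
      using r(1) by (auto simp: continuous_on_eq_continuous_within split_def B_def)
  qed (use r(1) in \<open>auto simp: B_def\<close>)
  moreover have "at (0, 0) within B \<times> B = at (0, 0)"
    using r(1) by (intro at_within_open) (auto simp: B_def open_Times)
  ultimately have "((\<lambda>(a, b). ?f a b) has_derivative
      (\<lambda>(s, t). partial_deriv i H z * s + partial_deriv k H z * t)) (at (0, 0))"
    by simp
  then have der: "((\<lambda>(a, b). ?f a b) has_derivative
      (\<lambda>(s, t). partial_deriv i H z * s + partial_deriv k H z * t)) (at (of_real 0 * c, of_real 0 * d))"
    by simp
  have "((\<lambda>t::real. (of_real t * c, of_real t * d)) has_derivative
      (\<lambda>h. (of_real h * c, of_real h * d))) (at 0)"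
    by (intro derivative_eq_intros) auto
  from has_derivative_compose[OF this der]
  have "((\<lambda>t::real. ?f (of_real t * c) (of_real t * d)) has_derivative
      (\<lambda>h. partial_deriv i H z * (of_real h * c) + partial_deriv k H z * (of_real h * d))) (at 0)"
    by simp
  then show ?thesis
    unfolding has_vector_derivative_def
    by (rule has_derivative_eq_rhs) (auto simp: algebra_simps scaleR_conv_of_real)
qed

section \<open>Joining, splitting and conjugating coordinate vectors; polydiscs\<close>

definition vec_join :: "'b ^ 'm::finite \<Rightarrow> 'b ^ 'n::finite \<Rightarrow> 'b ^ ('m + 'n)"
  where "vec_join x y = (\<chi> s. case s of Inl i \<Rightarrow> x $ i | Inr j \<Rightarrow> y $ j)"

definition vec_left :: "'b ^ ('m::finite + 'n::finite) \<Rightarrow> 'b ^ 'm"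
  where "vec_left z = (\<chi> i. z $ Inl i)"

definition vec_right :: "'b ^ ('m::finite + 'n::finite) \<Rightarrow> 'b ^ 'n"
  where "vec_right z = (\<chi> j. z $ Inr j)"

definition vec_cnj :: "complex ^ 'n \<Rightarrow> complex ^ 'n"
  where "vec_cnj x = (\<chi> i. cnj (x $ i))"

lemma vec_join_nth [simp]: "vec_join x y $ Inl i = x $ i" "vec_join x y $ Inr j = y $ j"
  by (auto simp: vec_join_def)

lemma vec_left_nth [simp]: "vec_left z $ i = z $ Inl i"
  by (simp add: vec_left_def)

lemma vec_right_nth [simp]: "vec_right z $ j = z $ Inr j"
  by (simp add: vec_right_def)

lemma vec_cnj_nth [simp]: "vec_cnj x $ i = cnj (x $ i)"
  by (simp add: vec_cnj_def)

lemma vec_cnj_cnj [simp]: "vec_cnj (vec_cnj x) = x"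
  by (simp add: vec_eq_iff)

lemma vec_cnj_add: "vec_cnj (x + y) = vec_cnj x + vec_cnj y"
  by (simp add: vec_eq_iff)

lemma vec_cnj_axis: "vec_cnj (axis i t) = axis i (cnj t)"
  by (simp add: vec_eq_iff axis_def)

lemma vec_left_join [simp]: "vec_left (vec_join x y) = x"
  by (simp add: vec_eq_iff)

lemma vec_right_join [simp]: "vec_right (vec_join x y) = y"
  by (simp add: vec_eq_iff)

lemma vec_join_left_right [simp]: "vec_join (vec_left z) (vec_right z) = z"
  by (auto simp: vec_eq_iff vec_join_def split: sum.split)

lemma vec_left_add_axis [simp]:
  fixes z :: "complex ^ ('m::finite + 'n::finite)"
  shows "vec_left (z + axis (Inl i) t) = vec_left z + axis i t" "vec_left (z + axis (Inr j) t) = vec_left z"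
  by (auto simp: vec_eq_iff axis_def)

lemma vec_right_add_axis [simp]:
  fixes z :: "complex ^ ('m::finite + 'n::finite)"
  shows "vec_right (z + axis (Inl i) t) = vec_right z" "vec_right (z + axis (Inr j) t) = vec_right z + axis j t"
  by (auto simp: vec_eq_iff axis_def)

lemma vec_join_add_axis:
  fixes x :: "complex ^ 'm" and y :: "complex ^ 'n"
  shows "vec_join x y + axis (Inl i) t = vec_join (x + axis i t) y"
    and "vec_join x y + axis (Inr j) t = vec_join x (y + axis j t)"
  by (auto simp: vec_eq_iff axis_def vec_join_def split: sum.split)

lemma continuous_on_vec_join [continuous_intros]:
  assumes "continuous_on S f" "continuous_on S g"
  shows "continuous_on S (\<lambda>x. vec_join (f x) (g x))"
  unfolding vec_join_def
proof (intro continuous_on_vec_lambda)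
  show "continuous_on S (\<lambda>x. case s of Inl i \<Rightarrow> f x $ i | Inr j \<Rightarrow> g x $ j)" for s
    by (cases s) (auto intro!: continuous_intros assms)
qed

lemma continuous_on_vec_left [continuous_intros]:
  "continuous_on S f \<Longrightarrow> continuous_on S (\<lambda>x. vec_left (f x))"
  unfolding vec_left_def by (intro continuous_intros)

lemma continuous_on_vec_right [continuous_intros]:
  "continuous_on S f \<Longrightarrow> continuous_on S (\<lambda>x. vec_right (f x))"
  unfolding vec_right_def by (intro continuous_intros)

lemma continuous_on_vec_cnj [continuous_intros]:
  "continuous_on S f \<Longrightarrow> continuous_on S (\<lambda>x. vec_cnj (f x))"
  unfolding vec_cnj_def by (intro continuous_intros)

text \<open>Products of discs rather than Euclidean balls: coordinates can be replaced one at a time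
  without leaving the set, and two polydiscs of equal radius join to a polydisc.\<close>

definition polydisc :: "complex ^ 'm \<Rightarrow> real \<Rightarrow> (complex ^ 'm) set"
  where "polydisc c r = {z. \<forall>i. dist (z $ i) (c $ i) < r}"

lemma open_polydisc: "open (polydisc c r)"
proof -
  have "polydisc c r = (\<Inter>i. {z. dist (z $ i) (c $ i) < r})" unfolding polydisc_def by auto
  moreover have "open {z. dist (z $ i) (c $ i) < r}" for i
    by (intro open_Collect_less continuous_intros)
  ultimately show ?thesis by auto
qed

lemma centre_in_polydisc: "r > 0 \<Longrightarrow> c \<in> polydisc c r"
  by (simp add: polydisc_def)

lemma polydisc_mono: "r \<le> s \<Longrightarrow> polydisc c r \<subseteq> polydisc c s"
  unfolding polydisc_def by (auto intro: less_le_trans)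

lemma open_contains_polydisc:
  assumes "open V" "c \<in> V"
  obtains r where "r > 0" "polydisc c r \<subseteq> V"
proof -
  obtain e where e: "e > 0" "ball c e \<subseteq> V" using assms openE by blast
  \<comment> \<open>The Euclidean distance is at most the sum of the coordinate distances, of which
    there are \<open>CARD('a)\<close>.\<close>
  define r where "r = e / CARD('a)"
  have "polydisc c r \<subseteq> ball c e"
  proof
    fix z assume "z \<in> polydisc c r"
    then have z: "\<And>i. dist (z $ i) (c $ i) < r" by (simp add: polydisc_def)
    have "dist z c \<le> (\<Sum>i\<in>UNIV. dist (z $ i) (c $ i))"
      unfolding dist_vec_def by (rule L2_set_le_sum) auto
    also have "\<dots> < of_nat (CARD('a)) * r"
      by (rule sum_bounded_above_strict) (use z in auto)
    also have "\<dots> = e" by (simp add: r_def)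
    finally show "z \<in> ball c e" by (simp add: dist_commute)
  qed
  moreover have "r > 0" using e by (simp add: r_def)
  ultimately show thesis using that e by blast
qed

lemma vec_join_in_polydisc [simp]:
  "vec_join x y \<in> polydisc (vec_join p q) r \<longleftrightarrow> x \<in> polydisc p r \<and> y \<in> polydisc q r"
  unfolding polydisc_def by (auto simp: vec_join_def split: sum.splits)

lemma vec_cnj_in_polydisc [simp]: "vec_cnj x \<in> polydisc (vec_cnj p) r \<longleftrightarrow> x \<in> polydisc p r"
  unfolding polydisc_def by (simp add: dist_norm flip: complex_cnj_diff)

lemma polydisc_vec_leftD: "z \<in> polydisc (vec_join p q) r \<Longrightarrow> vec_left z \<in> polydisc p r"
  by (metis vec_join_in_polydisc vec_join_left_right)

lemma polydisc_vec_rightD: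
  assumes "z \<in> polydisc (vec_join p (vec_cnj p)) r" shows "vec_cnj (vec_right z) \<in> polydisc p r"
proof -
  have "vec_right z \<in> polydisc (vec_cnj p) r"
    using assms by (metis vec_join_in_polydisc vec_join_left_right)
  then show ?thesis by (metis vec_cnj_cnj vec_cnj_in_polydisc)
qed

text \<open>In the parameter of the axis line through \<open>z\<close>, the polydisc is the disc
  about \<open>c $ i - z $ i\<close>; together with the next lemma this places one-variable
  arguments on a disc containing both the starting and the target parameter.\<close>

lemma polydisc_add_axis:
  "z \<in> polydisc c r \<Longrightarrow> t \<in> ball (c $ i - z $ i) r \<Longrightarrow> z + axis i t \<in> polydisc c r"
  unfolding polydisc_def by (auto simp: axis_def dist_norm norm_minus_commute algebra_simps)

lemma polydisc_shift_in_ball: "z' \<in> polydisc c r \<Longrightarrow> z' $ i - z $ i \<in> ball (c $ i - z $ i) r"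
  unfolding polydisc_def by (auto simp: dist_norm norm_minus_commute)

text \<open>The coordinates of \<open>z\<close> are changed into those of \<open>z'\<close> one
  after another; along each axis line the parameter disc is convex, so a zero derivative makes
  \<open>h\<close> constant there.\<close>

lemma constant_on_polydisc:
  assumes der: "\<And>z i. z \<in> polydisc c r \<Longrightarrow> ((\<lambda>t. h (z + axis i t)) has_field_derivative 0) (at 0)"
    and "z \<in> polydisc c r" "z' \<in> polydisc c r"
  shows "h z = (h z' :: complex)"
proof -
  \<comment> \<open>Induction on a set \<open>S\<close> of coordinates outside of which the two
    points agree.\<close>
  have "h z = h z'" if "finite S" "z \<in> polydisc c r" "z' \<in> polydisc c r" "\<forall>i. i \<notin> S \<longrightarrow> z $ i = z' $ i" for S z z'
    using that
  proof (induction S arbitrary: z)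
    case empty
    then show ?case by (metis empty_iff vec_eq_iff)
  next
    case (insert j S)
    define z1 where "z1 = z + axis j (z' $ j - z $ j)"
    let ?T = "ball (c $ j - z $ j) r"
    have T: "z' $ j - z $ j \<in> ?T" "z $ j - z $ j \<in> ?T"
      using insert.prems polydisc_shift_in_ball by blast+
    have "z1 \<in> polydisc c r" unfolding z1_def using polydisc_add_axis insert.prems T(1) by blast
    then have "h z1 = h z'" using insert.prems
      by (intro insert.IH) (auto simp: z1_def axis_def)
    have der0: "((\<lambda>t. h (z + axis j t)) has_field_derivative 0) (at t within ?T)" if "t \<in> ?T" for t
    proof -
      have "((\<lambda>s. h (z + axis j t + axis j s)) has_field_derivative 0) (at 0)"
        by (rule der[OF polydisc_add_axis[OF insert.prems(1) that]])
      then have "((\<lambda>s. h (z + axis j (s + t))) has_field_derivative 0) (at 0)"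
        by (simp add: axis_add add_ac)
      then have "((\<lambda>t. h (z + axis j t)) has_field_derivative 0) (at t)"
        using DERIV_shift[of "\<lambda>t. h (z + axis j t)" 0 0 t] by simp
      then show ?thesis by (rule has_field_derivative_at_within)
    qed
    have "\<exists>k. \<forall>t\<in>?T. h (z + axis j t) = k"
      by (rule has_field_derivative_zero_constant[OF convex_ball der0])
    then obtain k where "\<forall>t\<in>?T. h (z + axis j t) = k" by blast
    then have "h z1 = h z" using T unfolding z1_def by (metis add_0_right axis_0 diff_self)
    then show ?case using \<open>h z1 = h z'\<close> by simp
  qed
  from this[OF finite assms(2,3), of UNIV] show ?thesis by simp
qed

text \<open>The mirror set of points \<open>vec_join x (vec_cnj x)\<close> is totally real. The
  condition \<open>z $ Inr i = cnj (z $ Inl i)\<close> is given up one index at a time: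
  \<open>E S\<close> imposes it only outside \<open>S\<close>, and zeros pass from
  \<open>E S\<close> to \<open>E (insert j S)\<close> because all derivatives of \<open>G\<close> in
  the direction \<open>Inl j\<close> vanish on \<open>E S\<close>.\<close>

lemma polarization_polydisc:
  fixes G :: "complex ^ ('n::finite + 'n) \<Rightarrow> complex"
  assumes G: "osgood_holomorphic_on G \<Omega>" and \<Omega>: "\<Omega> = polydisc (vec_join p (vec_cnj p)) r"
    and zero: "\<And>x. x \<in> polydisc p r \<Longrightarrow> G (vec_join x (vec_cnj x)) = 0"
    and "z \<in> \<Omega>"
  shows "G z = 0"
proof -
  have "open \<Omega>" unfolding \<Omega> by (rule open_polydisc)
  define E where "E S = {z \<in> \<Omega>. \<forall>i. i \<notin> S \<longrightarrow> z $ Inr i = cnj (z $ Inl i)}" for S :: "'n set"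
  have "\<forall>z\<in>E S. G z = 0" if "finite S" for S
    using that
  proof (induction S)
    case empty
    show ?case
    proof
      fix z assume z: "z \<in> E {}"
      then have eq: "z = vec_join (vec_left z) (vec_cnj (vec_left z))"
        by (auto simp: E_def vec_eq_iff vec_join_def split: sum.split)
      have "vec_left z \<in> polydisc p r"
        using z polydisc_vec_leftD unfolding E_def \<Omega> by blast
      then show "G z = 0" using zero eq by metis
    qed
  next
    case (insert j S)
    define H where "H n = (partial_deriv (Inl j) ^^ n) G" for n
    have H: "osgood_holomorphic_on (H n) \<Omega>" for n
      unfolding H_def
      by (induction n) (simp_all add: G osgood_holomorphic_on_partial_deriv[OF \<open>open \<Omega>\<close>])
    have zeroH: "\<forall>z\<in>E S. H n z = 0" for n
    proof (induction n)
      case 0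
      then show ?case using insert.IH by (simp add: H_def)
    next
      case (Suc n)
      show ?case
      proof
        fix z assume z: "z \<in> E S"
        then have "z \<in> \<Omega>" by (simp add: E_def)
        \<comment> \<open>Since \<open>j \<notin> S\<close>, moving the coordinates
          \<open>Inl j\<close> and \<open>Inr j\<close> by \<open>t * c\<close> and
          \<open>t * cnj c\<close> with real \<open>t\<close> stays in \<open>E S\<close>, where
          \<open>H n\<close> is zero; so its derivative along this line vanishes.\<close>
        have eq: "c * partial_deriv (Inl j) (H n) z + cnj c * partial_deriv (Inr j) (H n) z = 0" for c
        proof -
          let ?\<gamma> = "\<lambda>t::real. z + axis (Inl j) (of_real t * c) + axis (Inr j) (of_real t * cnj c)"
          have "continuous_on UNIV ?\<gamma>" by (intro continuous_intros)
          then have op: "open (?\<gamma> -` \<Omega>)" using \<open>open \<Omega>\<close> by (simp add: open_vimage)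
          have "0 = H n (?\<gamma> t)" if "t \<in> ?\<gamma> -` \<Omega>" for t
          proof -
            have "?\<gamma> t \<in> E S"
              using that z insert.hyps by (auto simp: E_def axis_def)
            then show ?thesis using Suc by simp
          qed
          from has_vector_derivative_transform_within_open[OF has_vector_derivative_const op _ this]
          have "((\<lambda>t. H n (?\<gamma> t)) has_vector_derivative 0) (at 0)"
            using \<open>z \<in> \<Omega>\<close> by simp
          with osgood_holomorphic_on_two_axes[OF \<open>open \<Omega>\<close> H \<open>z \<in> \<Omega>\<close>, where c = c and d = "cnj c"]
          show ?thesis by (rule vector_derivative_unique_at)
        qed
        have "partial_deriv (Inl j) (H n) z = 0"
        proof -
          \<comment> \<open>The choices \<open>c = 1\<close> and \<open>c = \<i>\<close> separate
            the two partial derivatives.\<close>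
          have "2 * partial_deriv (Inl j) (H n) z = (1 * partial_deriv (Inl j) (H n) z + cnj 1 * partial_deriv (Inr j) (H n) z)
              - \<i> * (\<i> * partial_deriv (Inl j) (H n) z + cnj \<i> * partial_deriv (Inr j) (H n) z)"
            by (simp add: algebra_simps)
          then show ?thesis unfolding eq by simp
        qed
        then show "H (Suc n) z = 0" by (simp add: H_def)
      qed
    qed
    show ?case
    proof
      fix z assume z: "z \<in> E (insert j S)"
      then have "z \<in> \<Omega>" by (simp add: E_def)
      \<comment> \<open>Only the coordinate \<open>Inl j\<close> is changed, to the value demanded
        by the mirror condition at \<open>j\<close>; this puts \<open>z0\<close> into
        \<open>E S\<close>, and \<open>z\<close> lies on the axis line through
        \<open>z0\<close>.\<close>
      define z0 where "z0 = z + axis (Inl j) (cnj (z $ Inr j) - z $ Inl j)"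
      have "z0 \<in> \<Omega>"
        unfolding z0_def \<Omega>
      proof (rule polydisc_add_axis)
        show "z \<in> polydisc (vec_join p (vec_cnj p)) r" using \<open>z \<in> \<Omega>\<close> \<Omega> by simp
        have "dist (cnj (z $ Inr j)) (p $ j) < r"
          using polydisc_vec_rightD[of z p r] \<open>z \<in> \<Omega>\<close> unfolding \<Omega> polydisc_def by simp
        then show "cnj (z $ Inr j) - z $ Inl j \<in> ball (vec_join p (vec_cnj p) $ Inl j - z $ Inl j) r"
          by (simp add: dist_norm norm_minus_commute)
      qed
      then have "z0 \<in> E S" using z by (auto simp: E_def z0_def axis_def)
      define T where "T = ball (p $ j - z0 $ Inl j) r"
      have T: "z0 + axis (Inl j) t \<in> \<Omega>" if "t \<in> T" for t
        unfolding \<Omega> by (rule polydisc_add_axis) (use that \<open>z0 \<in> \<Omega>\<close> in \<open>auto simp: T_def \<Omega>\<close>)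
      have der: "((\<lambda>t. H n (z0 + axis (Inl j) t)) has_field_derivative H (Suc n) (z0 + axis (Inl j) t)) (at t)"
        if "t \<in> T" for n t
        using osgood_holomorphic_on_line[OF H[of n] T[OF that]] by (simp add: H_def)
      have dern: "(deriv ^^ n) (\<lambda>t. G (z0 + axis (Inl j) t)) t = H n (z0 + axis (Inl j) t)" if "t \<in> T" for n t
        using that
      proof (induction n arbitrary: t)
        case (Suc n)
        have "deriv ((deriv ^^ n) (\<lambda>t. G (z0 + axis (Inl j) t))) t = deriv (\<lambda>t. H n (z0 + axis (Inl j) t)) t"
        proof (rule deriv_cong_ev)
          have "\<forall>\<^sub>F s in nhds t. s \<in> T"
            using Suc.prems unfolding T_def by (intro eventually_nhds_in_open) auto
          then show "\<forall>\<^sub>F s in nhds t. (deriv ^^ n) (\<lambda>t. G (z0 + axis (Inl j) t)) s = H n (z0 + axis (Inl j) s)"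
            by (rule eventually_mono) (rule Suc.IH)
        qed simp
        then show ?case using DERIV_imp_deriv[OF der[OF Suc.prems]] by simp
      qed (simp add: H_def)
      \<comment> \<open>On the disc \<open>T\<close> the one-variable restriction has only zero
        derivatives at the parameter 0, so it vanishes identically, in particular at the parameter
        of \<open>z\<close>.\<close>
      have "G (z0 + axis (Inl j) (z $ Inl j - z0 $ Inl j)) = 0"
      proof (rule holomorphic_fun_eq_0_on_connected[where f = "\<lambda>t. G (z0 + axis (Inl j) t)" and z = 0 and S = T])
        show "(\<lambda>t. G (z0 + axis (Inl j) t)) holomorphic_on T"
          using der[of _ 0] unfolding holomorphic_on_def field_differentiable_def H_def
          by (auto intro: has_field_derivative_at_within)
        show "0 \<in> T" "z $ Inl j - z0 $ Inl j \<in> T"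
          using polydisc_shift_in_ball[of z0 _ r "Inl j" z0] polydisc_shift_in_ball[of z _ r "Inl j" z0]
            \<open>z0 \<in> \<Omega>\<close> \<open>z \<in> \<Omega>\<close> unfolding \<Omega> T_def by force+
        then show "(deriv ^^ n) (\<lambda>t. G (z0 + axis (Inl j) t)) 0 = 0" for n
          using dern zeroH \<open>z0 \<in> E S\<close> by simp
      qed (auto simp: T_def)
      moreover have "z0 + axis (Inl j) (z $ Inl j - z0 $ Inl j) = z"
        by (auto simp: vec_eq_iff z0_def axis_def)
      ultimately show "G z = 0" by simp
    qed
  qed
  from this[of UNIV] show ?thesis using \<open>z \<in> \<Omega>\<close> by (auto simp: E_def)
qed

text \<open>Conjugating the second argument turns a sesqui-holomorphic bi-function into a holomorphic
  function of twice as many variables.\<close>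

definition holomorphic_form ::
    "(complex ^ 'n \<Rightarrow> complex ^ 'n \<Rightarrow> complex) \<Rightarrow> complex ^ ('n::finite + 'n) \<Rightarrow> complex"
  where "holomorphic_form F z = F (vec_left z) (vec_cnj (vec_right z))"

text \<open>Along an \<open>Inr\<close> axis, both the argument and the value of the holomorphic
  function \<open>cnj (F x _)\<close> are conjugated, which preserves complex
  differentiability.\<close>

lemma osgood_holomorphic_on_holomorphic_form:
  fixes F :: "complex ^ 'n \<Rightarrow> complex ^ 'n \<Rightarrow> complex"
  assumes F: "sesqui_holomorphic_on F V" and cont: "continuous_on (V \<times> V) (\<lambda>(x, y). F x y)"
    and sub: "polydisc p r \<subseteq> V"
  shows "osgood_holomorphic_on (holomorphic_form F) (polydisc (vec_join p (vec_cnj p)) r)"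
proof -
  let ?\<Omega> = "polydisc (vec_join p (vec_cnj p)) r"
  have parts: "vec_left z \<in> V" "vec_cnj (vec_right z) \<in> V" if "z \<in> ?\<Omega>" for z
    using polydisc_vec_leftD[OF that] polydisc_vec_rightD[OF that] sub by auto
  have axis_smult: "axis j t = t *s (axis j 1 :: complex ^ 'n)" for j t
    by (simp add: vec_eq_iff axis_def)
  show ?thesis unfolding osgood_holomorphic_on_def
  proof (intro conjI ballI allI)
    have "continuous_on ?\<Omega> (\<lambda>z. (\<lambda>(x, y). F x y) (vec_left z, vec_cnj (vec_right z)))"
      by (rule continuous_on_compose2[OF cont]) (use parts in \<open>auto intro!: continuous_intros\<close>)
    then show "continuous_on ?\<Omega> (holomorphic_form F)"
      unfolding holomorphic_form_def by simp
  next
    fix z i assume z: "z \<in> ?\<Omega>"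
    define x where "x = vec_left z"
    define y where "y = vec_cnj (vec_right z)"
    have xy: "x \<in> V" "y \<in> V" using parts[OF z] by (auto simp: x_def y_def)
    show "(\<lambda>t. holomorphic_form F (z + axis i t)) field_differentiable at 0"
    proof (cases i)
      case (Inl j)
      have "(\<lambda>t. F (x + t *s axis j 1) y) field_differentiable at 0"
        by (rule holomorphic_several_on_line[OF sesqui_holomorphic_on_holomorphic[OF F xy(2)]])
           (use xy in simp)
      then show ?thesis by (simp add: Inl holomorphic_form_def axis_smult[symmetric] flip: x_def y_def)
    next
      case (Inr j)
      have "(\<lambda>t. cnj (F x (y + t *s axis j 1))) field_differentiable at 0"
        by (rule holomorphic_several_on_line[OF sesqui_holomorphic_on_cnj[OF F xy(1)]])
           (use xy in simp)
      then obtain D where "((\<lambda>t. cnj (F x (y + t *s axis j 1))) has_field_derivative D) (at (cnj 0))"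
        unfolding field_differentiable_def by auto
      from has_field_derivative_cnj_cnj[OF this]
      have "((\<lambda>t. F x (y + cnj t *s axis j 1)) has_field_derivative cnj D) (at 0)"
        by (simp add: o_def)
      moreover have "holomorphic_form F (z + axis i t) = F x (y + cnj t *s axis j 1)" for t
        by (simp add: Inr holomorphic_form_def x_def y_def vec_cnj_add vec_cnj_axis axis_smult[symmetric])
      ultimately show ?thesis unfolding field_differentiable_def by auto
    qed
  qed
qed

text \<open>Density carries the zeros on the diagonal from \<open>S\<close> to a small open
  \<open>V\<close> on which \<open>F\<close> is jointly continuous; the holomorphic form then
  vanishes over a polydisc in \<open>V\<close>, and the identity theorem spreads the zeros to
  \<open>X \<times> X\<close>.\<close>

lemma sesqui_holomorphic_polarization:
  fixes F :: "complex ^ 'n \<Rightarrow> complex ^ 'n \<Rightarrow> complex"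
  assumes X: "open X" "connected X" and F: "sesqui_holomorphic_on F X"
    and S: "S \<subseteq> X" "somewhere_dense S" and zero: "\<And>x. x \<in> S \<Longrightarrow> F x x = 0"
    and "x \<in> X" "y \<in> X"
  shows "F x y = 0"
proof -
  \<comment> \<open>The closure of \<open>S\<close> may leave \<open>X\<close>, hence the
    intersection; it is non-empty because an open set meeting \<open>closure S\<close> meets
    \<open>S\<close> itself.\<close>
  define W where "W = interior (closure S) \<inter> X"
  have W: "open W" "W \<subseteq> X" using X(1) by (auto simp: W_def)
  have "W \<noteq> {}"
  proof -
    obtain p where "p \<in> interior (closure S)" using S(2) unfolding somewhere_dense_def by blast
    then have "interior (closure S) \<inter> S \<noteq> {}"
      using interior_subset[of "closure S"] open_Int_closure_eq_empty[OF open_interior] by blast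
    then show ?thesis using S(1) by (auto simp: W_def)
  qed
  obtain V where V: "open V" "V \<noteq> {}" "V \<subseteq> W" and cont: "continuous_on (V \<times> V) (\<lambda>(x, y). F x y)"
    using sesqui_holomorphic_locally_continuous[OF F W(1) \<open>W \<noteq> {}\<close> W(2)] by blast
  \<comment> \<open>Separate continuity would not make \<open>F x x\<close> continuous in
    \<open>x\<close>; here joint continuity on \<open>V \<times> V\<close> is used.\<close>
  have zeroV: "F x x = 0" if "x \<in> V" for x
  proof (rule ccontr)
    assume nz: "F x x \<noteq> 0"
    have "continuous_on V (\<lambda>x. (\<lambda>(x, y). F x y) (x, x))"
      by (rule continuous_on_compose2[OF cont]) (auto intro!: continuous_intros)
    then have "open (V \<inter> (\<lambda>x. F x x) -` (- {0}))"
      using continuous_open_preimage[OF _ V(1) open_Compl[OF closed_singleton[of 0]], of "\<lambda>x. F x x"]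
      by simp
    moreover have "x \<in> V \<inter> (\<lambda>x. F x x) -` (- {0})" "x \<in> closure S"
      using nz that V(3) interior_subset unfolding W_def by auto
    ultimately have "V \<inter> (\<lambda>x. F x x) -` (- {0}) \<inter> S \<noteq> {}"
      using open_Int_closure_eq_empty by blast
    then show False using zero by auto
  qed
  obtain p where "p \<in> V" using V(2) by blast
  obtain r where r: "r > 0" "polydisc p r \<subseteq> V" using open_contains_polydisc[OF V(1) \<open>p \<in> V\<close>] by blast
  have FV: "sesqui_holomorphic_on F V" using sesqui_holomorphic_on_subset[OF F] V(3) W(2) by blast
  have "F a b = 0" if "a \<in> polydisc p r" "b \<in> polydisc p r" for a b
  proof -
    have "holomorphic_form F (vec_join a (vec_cnj b)) = 0"
      by (rule polarization_polydisc[OF osgood_holomorphic_on_holomorphic_form[OF FV cont r(2)] refl])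
         (use that zeroV r(2) in \<open>auto simp: holomorphic_form_def\<close>)
    then show ?thesis by (simp add: holomorphic_form_def)
  qed
  then show ?thesis
    using sesqui_holomorphic_eq_0[OF X F open_polydisc[of p r]] centre_in_polydisc[OF r(1), of p]
      r(2) V(3) W(2) \<open>x \<in> X\<close> \<open>y \<in> X\<close> by blast
qed

subsection \<open>Mixed logarithmic derivatives\<close>

text \<open>Near \<open>a\<close>, any continuous branch equals \<open>g a + Ln (f t / f a)\<close>:
  the quotient is 1 at \<open>a\<close>, away from the cut of \<open>Ln\<close>, and continuity
  keeps the imaginary part of \<open>g t - g a\<close> below \<open>pi\<close> in absolute value, so
  \<open>Ln\<close> inverts \<open>exp\<close> on it.\<close>

lemma has_vector_derivative_log_branch:
  fixes g f :: "real \<Rightarrow> complex"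
  assumes f: "(f has_vector_derivative D) (at a)" and g: "isCont g a"
    and ex: "\<forall>\<^sub>F t in nhds a. exp (g t) = f t"
  shows "(g has_vector_derivative D / f a) (at a)"
proof -
  have fa: "f a = exp (g a)" using eventually_nhds_x_imp_x[OF ex] by simp
  have "((\<lambda>t. f t / f a) has_vector_derivative D / f a) (at a)"
    using has_vector_derivative_divide[OF f] .
  moreover have "(Ln has_field_derivative 1) (at (f a / f a))"
    using has_field_derivative_Ln[of 1] fa by simp
  ultimately have "((Ln \<circ> (\<lambda>t. f t / f a)) has_vector_derivative D / f a * 1) (at a)"
    by (rule field_vector_diff_chain_at)
  then have der: "((\<lambda>t. g a + Ln (f t / f a)) has_vector_derivative D / f a) (at a)"
    using has_vector_derivative_add[OF has_vector_derivative_const] by (fastforce simp: o_def)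
  have "\<forall>\<^sub>F t in nhds a. dist (g t) (g a) < pi"
    using g pi_gt_zero by (simp add: isCont_def tendsto_at_iff_tendsto_nhds tendstoD)
  with ex have ev: "\<forall>\<^sub>F t in nhds a. g a + Ln (f t / f a) = g t"
  proof eventually_elim
    case (elim t)
    have "\<bar>Im (g t - g a)\<bar> < pi"
      using elim(2) abs_Im_le_cmod[of "g t - g a"] by (simp add: dist_norm)
    then have "Ln (exp (g t - g a)) = g t - g a" by (intro Ln_exp) auto
    then show ?case using elim(1) fa by (simp add: exp_diff)
  qed
  show ?thesis
    by (rule has_vector_derivative_cong_ev[THEN iffD1, OF _ _ der])
       (use ev eventually_nhds_x_imp_x[OF ev] in \<open>auto elim: eventually_mono\<close>)
qed

text \<open>A real step in the direction \<open>axis j c\<close> moves the joined vector by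
  \<open>c\<close> along \<open>Inl j\<close> and by \<open>cnj c\<close> along
  \<open>Inr j\<close>.\<close>

lemma has_vector_derivative_on_mirror:
  assumes "open \<Omega>" and H: "osgood_holomorphic_on H \<Omega>" and x: "vec_join x (vec_cnj x) \<in> \<Omega>"
  shows "((\<lambda>t. H (vec_join (x + t *\<^sub>R axis j c) (vec_cnj (x + t *\<^sub>R axis j c)))) has_vector_derivative
     c * partial_deriv (Inl j) H (vec_join x (vec_cnj x)) +
     cnj c * partial_deriv (Inr j) H (vec_join x (vec_cnj x))) (at 0)"
proof -
  have "t *\<^sub>R axis j c = axis j (of_real t * c)" for t
    by (simp add: vec_eq_iff axis_def) (simp add: scaleR_conv_of_real)
  then show ?thesis
    using osgood_holomorphic_on_two_axes[OF assms, of "Inl j" c "Inr j" "cnj c"]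
    by (simp add: vec_join_add_axis vec_cnj_add vec_cnj_axis)
qed

lemma eventually_line_in_open:
  fixes x v :: "'a::real_normed_vector"
  assumes "open S" "x \<in> S"
  shows "\<forall>\<^sub>F t in nhds (0::real). x + t *\<^sub>R v \<in> S"
proof -
  have "continuous_on UNIV (\<lambda>t::real. x + t *\<^sub>R v)" by (intro continuous_intros)
  then have "open ((\<lambda>t::real. x + t *\<^sub>R v) -` S)" using assms(1) by (simp add: open_vimage)
  then show ?thesis using eventually_nhds_in_open[of "(\<lambda>t::real. x + t *\<^sub>R v) -` S" 0] assms(2) by simp
qed

text \<open>Combining the real directions \<open>c = 1\<close> and \<open>c = \<i>\<close>,
  \<open>wirtinger_bar k\<close> leaves only the \<open>Inr k\<close> derivative and
  \<open>wirtinger j\<close> only the \<open>Inl j\<close> derivative. This expresses condition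
  (iii) by holomorphic derivatives on the mirror set.\<close>

lemma wirtinger_log_branch:
  fixes G :: "complex ^ ('n::finite + 'n) \<Rightarrow> complex"
  assumes G: "osgood_holomorphic_on G \<Omega>" and \<Omega>: "\<Omega> = polydisc (vec_join p (vec_cnj p)) r"
    and nz: "\<And>z. z \<in> \<Omega> \<Longrightarrow> G z \<noteq> 0"
    and F: "\<And>x. x \<in> polydisc p r \<Longrightarrow> F x = G (vec_join x (vec_cnj x))"
    and x: "x \<in> polydisc p r" and l: "log_branch_near x F l"
  shows "wirtinger j (wirtinger_bar k l) x =
    partial_deriv (Inl j) (\<lambda>z. partial_deriv (Inr k) G z / G z) (vec_join x (vec_cnj x))"
proof -
  have "open \<Omega>" unfolding \<Omega> by (rule open_polydisc)
  define K where "K = (\<lambda>z. partial_deriv (Inr k) G z / G z)"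
  have K: "osgood_holomorphic_on K \<Omega>"
    unfolding K_def
    by (intro osgood_holomorphic_on_divide osgood_holomorphic_on_partial_deriv[OF \<open>open \<Omega>\<close>] G nz)
  obtain V where V: "open V" "x \<in> V" "continuous_on V l" "\<And>v. v \<in> V \<Longrightarrow> exp (l v) = F v"
    using l unfolding log_branch_near_def by blast
  define V' where "V' = V \<inter> polydisc p r"
  have V': "open V'" "x \<in> V'" using V x open_polydisc by (auto simp: V'_def)
  \<comment> \<open>Needed on a whole neighbourhood of \<open>x\<close>, since this function is
    differentiated once more.\<close>
  have bar: "wirtinger_bar k l y = K (vec_join y (vec_cnj y))" if y: "y \<in> V'" for y
  proof -
    let ?z = "vec_join y (vec_cnj y)"
    have "?z \<in> \<Omega>" using y by (simp add: \<Omega> V'_def)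
    have rp: "real_partial (axis k c) l y =
        (c * partial_deriv (Inl k) G ?z + cnj c * partial_deriv (Inr k) G ?z) / G ?z" for c
    proof -
      let ?y = "\<lambda>t::real. y + t *\<^sub>R axis k c"
      have "((\<lambda>t. l (?y t)) has_vector_derivative
          (c * partial_deriv (Inl k) G ?z + cnj c * partial_deriv (Inr k) G ?z) /
            G (vec_join (?y 0) (vec_cnj (?y 0)))) (at 0)"
      proof (rule has_vector_derivative_log_branch[OF has_vector_derivative_on_mirror[OF \<open>open \<Omega>\<close> G \<open>?z \<in> \<Omega>\<close>]])
        have "isCont l (?y 0)"
          using V(1,3) y by (simp add: V'_def continuous_on_eq_continuous_at)
        then show "isCont (\<lambda>t. l (?y t)) 0"
          by (rule isCont_o2[rotated]) (intro continuous_intros)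
        show "\<forall>\<^sub>F t in nhds 0. exp (l (?y t)) = G (vec_join (?y t) (vec_cnj (?y t)))"
          by (rule eventually_mono[OF eventually_line_in_open[OF V'(1) y, of "axis k c"]]) (use V(4) F in \<open>auto simp: V'_def\<close>)
      qed
      then show ?thesis unfolding real_partial_def by (simp add: vector_derivative_at)
    qed
    show ?thesis unfolding wirtinger_bar_def rp K_def
      by (simp add: diff_divide_distrib add_divide_distrib algebra_simps)
  qed
  let ?z = "vec_join x (vec_cnj x)"
  have "?z \<in> \<Omega>" using x by (simp add: \<Omega>)
  have rp: "real_partial (axis j c) (wirtinger_bar k l) x =
      c * partial_deriv (Inl j) K ?z + cnj c * partial_deriv (Inr j) K ?z" for c
  proof -
    let ?y = "\<lambda>t::real. x + t *\<^sub>R axis j c"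
    have "\<forall>\<^sub>F t in nhds 0. wirtinger_bar k l (?y t) = K (vec_join (?y t) (vec_cnj (?y t)))"
      by (rule eventually_mono[OF eventually_line_in_open[OF V'] bar])
    then have "vector_derivative (\<lambda>t. wirtinger_bar k l (?y t)) (at 0) =
        vector_derivative (\<lambda>t. K (vec_join (?y t) (vec_cnj (?y t)))) (at 0)"
      by (intro vector_derivative_cong_eq) auto
    then show ?thesis
      using vector_derivative_at[OF has_vector_derivative_on_mirror[OF \<open>open \<Omega>\<close> K \<open>?z \<in> \<Omega>\<close>]]
      unfolding real_partial_def by simp
  qed
  show ?thesis unfolding wirtinger_def rp K_def[symmetric] by (simp add: algebra_simps)
qed

lemma log_branch_near_exists:
  assumes "open Q" "x \<in> Q" "continuous_on Q F" "F x \<noteq> 0"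
  shows "\<exists>l. log_branch_near x F l"
proof -
  \<comment> \<open>Where \<open>F v / F x\<close> has positive real part, the principal logarithm
    is continuous.\<close>
  define V where "V = Q \<inter> (\<lambda>v. F v / F x) -` {z. 0 < Re z}"
  have contq: "continuous_on Q (\<lambda>v. F v / F x)" using assms by (intro continuous_intros) auto
  have "open V" unfolding V_def
    by (rule continuous_open_preimage[OF contq assms(1) open_halfspace_Re_gt])
  moreover have "x \<in> V" using assms by (simp add: V_def)
  moreover have "continuous_on V (\<lambda>v. Ln (F x) + Ln (F v / F x))"
    by (intro continuous_intros continuous_on_subset[OF contq])
       (auto simp: V_def complex_nonpos_Reals_iff)
  moreover have "exp (Ln (F x) + Ln (F v / F x)) = F v" if "v \<in> V" for v
  proof -
    have "F v / F x \<noteq> 0" using that by (auto simp: V_def)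
    then show ?thesis using assms(4) by (simp add: exp_add)
  qed
  ultimately show ?thesis unfolding log_branch_near_def by blast
qed

text \<open>The open set is shrunk for joint continuity of \<open>L\<close>, then of
  \<open>M\<close>, and finally to a polydisc on which both forms are non-zero. The last is possible
  because at the mirror point of the centre they take the diagonal values, non-zero by
  non-degeneracy.\<close>

lemma sesqui_holomorphic_local_pair:
  fixes L M :: "complex ^ 'n \<Rightarrow> complex ^ 'n \<Rightarrow> complex"
  assumes L: "sesqui_holomorphic_on L X" "nondegenerate_on L X"
    and M: "sesqui_holomorphic_on M X" "nondegenerate_on M X"
    and W: "open W" "W \<noteq> {}" "W \<subseteq> X"
  obtains p r where "r > 0" "polydisc p r \<subseteq> W"
    "osgood_holomorphic_on (holomorphic_form L) (polydisc (vec_join p (vec_cnj p)) r)"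
    "osgood_holomorphic_on (holomorphic_form M) (polydisc (vec_join p (vec_cnj p)) r)"
    "\<And>z. z \<in> polydisc (vec_join p (vec_cnj p)) r \<Longrightarrow> holomorphic_form L z \<noteq> 0"
    "\<And>z. z \<in> polydisc (vec_join p (vec_cnj p)) r \<Longrightarrow> holomorphic_form M z \<noteq> 0"
proof -
  obtain V where V: "open V" "V \<noteq> {}" "V \<subseteq> W" "continuous_on (V \<times> V) (\<lambda>(x, y). L x y)"
    using sesqui_holomorphic_locally_continuous[OF L(1) W] by blast
  obtain U where U: "open U" "U \<noteq> {}" "U \<subseteq> V" "continuous_on (U \<times> U) (\<lambda>(x, y). M x y)"
    using sesqui_holomorphic_locally_continuous[OF M(1) V(1,2)] V(3) W(3) by blast
  have contL: "continuous_on (U \<times> U) (\<lambda>(x, y). L x y)"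
    by (rule continuous_on_subset[OF V(4)]) (use U(3) in auto)
  have "U \<subseteq> X" using U V W by blast
  obtain p where p: "p \<in> U" using U(2) by blast
  obtain s where s: "s > 0" "polydisc p s \<subseteq> U" using open_contains_polydisc[OF U(1) p] by blast
  let ?\<Omega> = "\<lambda>r. polydisc (vec_join p (vec_cnj p)) r"
  have GL: "osgood_holomorphic_on (holomorphic_form L) (?\<Omega> r)" and GM: "osgood_holomorphic_on (holomorphic_form M) (?\<Omega> r)"
    if "r \<le> s" for r
  proof -
    have "polydisc p r \<subseteq> U" using s(2) polydisc_mono[OF that] by blast
    then show "osgood_holomorphic_on (holomorphic_form L) (?\<Omega> r)" "osgood_holomorphic_on (holomorphic_form M) (?\<Omega> r)"
      using osgood_holomorphic_on_holomorphic_form[OF sesqui_holomorphic_on_subset[OF L(1) \<open>U \<subseteq> X\<close>] contL]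
        osgood_holomorphic_on_holomorphic_form[OF sesqui_holomorphic_on_subset[OF M(1) \<open>U \<subseteq> X\<close>] U(4)]
      by auto
  qed
  define N where "N = ?\<Omega> s \<inter> (\<lambda>z. holomorphic_form L z * holomorphic_form M z) -` (- {0})"
  have "open N" unfolding N_def
    using GL[OF order_refl] GM[OF order_refl] unfolding osgood_holomorphic_on_def
    by (intro continuous_open_preimage open_polydisc continuous_intros open_Compl closed_singleton) auto
  moreover have "vec_join p (vec_cnj p) \<in> N"
    using L(2) M(2) p \<open>U \<subseteq> X\<close> s(1) unfolding N_def nondegenerate_on_def diagonal_def
    by (auto simp: holomorphic_form_def centre_in_polydisc)
  ultimately obtain r' where r': "r' > 0" "?\<Omega> r' \<subseteq> N" by (rule open_contains_polydisc)
  define r where "r = min r' s"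
  have r: "?\<Omega> r \<subseteq> N" using r'(2) polydisc_mono[of r r'] unfolding r_def by auto
  show thesis
  proof
    show "r > 0" using r' s by (simp add: r_def)
    show "polydisc p r \<subseteq> W" using s(2) U(3) V(3) polydisc_mono[of r s p] unfolding r_def by (meson min.cobounded2 subset_trans)
    show "osgood_holomorphic_on (holomorphic_form L) (?\<Omega> r)" "osgood_holomorphic_on (holomorphic_form M) (?\<Omega> r)"
      using GL GM by (auto simp: r_def)
    show "holomorphic_form L z \<noteq> 0" "holomorphic_form M z \<noteq> 0" if "z \<in> ?\<Omega> r" for z
      using that r by (auto simp: N_def)
  qed
qed

text \<open>The factors \<open>f\<close> and \<open>g\<close> are arbitrary functions.
  Differentiability of \<open>g\<close> along the axis follows from \<open>g = B / (f * A)\<close>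
  with \<open>f\<close> frozen at \<open>vec_left z\<close>; the product rule then gives the
  sum.\<close>

lemma log_derivative_rescaling:
  fixes A B :: "complex ^ ('n::finite + 'n) \<Rightarrow> complex"
  assumes A: "osgood_holomorphic_on A \<Omega>" and B: "osgood_holomorphic_on B \<Omega>" and "open \<Omega>"
    and nzA: "\<And>z. z \<in> \<Omega> \<Longrightarrow> A z \<noteq> 0" and nzB: "\<And>z. z \<in> \<Omega> \<Longrightarrow> B z \<noteq> 0"
    and eq: "\<And>z. z \<in> \<Omega> \<Longrightarrow> B z = f (vec_left z) * g (vec_right z) * A z"
    and z: "z \<in> \<Omega>"
  shows "partial_deriv (Inr k) B z / B z =
    partial_deriv (Inr k) A z / A z + deriv (\<lambda>t. g (vec_right z + axis k t)) 0 / g (vec_right z)"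
proof -
  let ?f = "f (vec_left z)" and ?g = "\<lambda>t. g (vec_right z + axis k t)"
  let ?A = "\<lambda>t. A (z + axis (Inr k) t)" and ?B = "\<lambda>t. B (z + axis (Inr k) t)"
  have dA: "(?A has_field_derivative partial_deriv (Inr k) A z) (at 0)"
    and dB: "(?B has_field_derivative partial_deriv (Inr k) B z) (at 0)"
    using osgood_holomorphic_on_line[OF A, of z "Inr k" 0] osgood_holomorphic_on_line[OF B, of z "Inr k" 0] z
    by auto
  have nzfg: "?f \<noteq> 0" "g (vec_right z) \<noteq> 0" using eq[OF z] nzB[OF z] by auto
  obtain r where r: "r > 0" "\<And>u x. x \<in> ball z r \<Longrightarrow> cmod u \<le> r \<Longrightarrow> x + axis (Inr k) u \<in> \<Omega>"
    using open_axis_neighbourhood[OF \<open>open \<Omega>\<close> z] by metis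
  have "\<forall>\<^sub>F t in nhds 0. t \<in> ball (0::complex) r"
    using r(1) by (intro eventually_nhds_in_open) auto
  then have ev: "\<forall>\<^sub>F t in nhds 0. ?g t = ?B t / (?f * ?A t)"
  proof (rule eventually_mono)
    fix t :: complex assume "t \<in> ball 0 r"
    then have "z + axis (Inr k) t \<in> \<Omega>" using r by simp
    from eq[OF this] nzA[OF this] nzfg show "?g t = ?B t / (?f * ?A t)" by simp
  qed
  moreover have "((\<lambda>t. ?B t / (?f * ?A t)) has_field_derivative
      (partial_deriv (Inr k) B z * (?f * A z) - B z * (?f * partial_deriv (Inr k) A z)) / ((?f * A z) * (?f * A z))) (at 0)"
    using DERIV_divide[OF dB DERIV_cmult[OF dA, of ?f]] nzfg nzA[OF z] by simp
  ultimately have "(?g has_field_derivative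
      (partial_deriv (Inr k) B z * (?f * A z) - B z * (?f * partial_deriv (Inr k) A z)) / ((?f * A z) * (?f * A z))) (at 0)"
    unfolding DERIV_cong_ev[OF refl ev refl] by blast
  then have "deriv ?g 0 =
      (partial_deriv (Inr k) B z * (?f * A z) - B z * (?f * partial_deriv (Inr k) A z)) / ((?f * A z) * (?f * A z))"
    by (rule DERIV_imp_deriv)
  also have "\<dots> = partial_deriv (Inr k) B z / (?f * A z) - g (vec_right z) * (partial_deriv (Inr k) A z / A z)"
    using nzfg nzA[OF z] by (simp add: eq[OF z] diff_divide_distrib)
  finally show ?thesis using nzfg nzA[OF z] by (simp add: eq[OF z] diff_divide_distrib)
qed

text \<open>The extra summand of the previous lemma depends on \<open>vec_right z\<close> only, so
  the \<open>Inl j\<close> derivative removes it.\<close>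

lemma mixed_log_derivative_rescaling:
  fixes A B :: "complex ^ ('n::finite + 'n) \<Rightarrow> complex"
  assumes A: "osgood_holomorphic_on A \<Omega>" and B: "osgood_holomorphic_on B \<Omega>" and "open \<Omega>"
    and nzA: "\<And>z. z \<in> \<Omega> \<Longrightarrow> A z \<noteq> 0" and nzB: "\<And>z. z \<in> \<Omega> \<Longrightarrow> B z \<noteq> 0"
    and eq: "\<And>z. z \<in> \<Omega> \<Longrightarrow> B z = f (vec_left z) * g (vec_right z) * A z"
    and z: "z \<in> \<Omega>"
  shows "partial_deriv (Inl j) (\<lambda>z. partial_deriv (Inr k) B z / B z) z =
    partial_deriv (Inl j) (\<lambda>z. partial_deriv (Inr k) A z / A z) z"
proof -
  let ?K = "\<lambda>z. partial_deriv (Inr k) A z / A z"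
  let ?b = "deriv (\<lambda>t. g (vec_right z + axis k t)) 0 / g (vec_right z)"
  have K: "osgood_holomorphic_on ?K \<Omega>"
    by (intro osgood_holomorphic_on_divide osgood_holomorphic_on_partial_deriv A nzA \<open>open \<Omega>\<close>)
  obtain r where r: "r > 0" "\<And>u x. x \<in> ball z r \<Longrightarrow> cmod u \<le> r \<Longrightarrow> x + axis (Inl j) u \<in> \<Omega>"
    using open_axis_neighbourhood[OF \<open>open \<Omega>\<close> z] by metis
  have "\<forall>\<^sub>F t in nhds 0. t \<in> ball (0::complex) r"
    using r(1) by (intro eventually_nhds_in_open) auto
  then have ev: "\<forall>\<^sub>F t in nhds 0. partial_deriv (Inr k) B (z + axis (Inl j) t) / B (z + axis (Inl j) t) =
      ?K (z + axis (Inl j) t) + ?b"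
  proof (rule eventually_mono)
    fix t :: complex assume "t \<in> ball 0 r"
    then have "z + axis (Inl j) t \<in> \<Omega>" using r by simp
    from log_derivative_rescaling[OF assms(1-6) this]
    show "partial_deriv (Inr k) B (z + axis (Inl j) t) / B (z + axis (Inl j) t) =
      ?K (z + axis (Inl j) t) + ?b" by simp
  qed
  have "((\<lambda>t. ?K (z + axis (Inl j) t) + ?b) has_field_derivative partial_deriv (Inl j) ?K z + 0) (at 0)"
    using osgood_holomorphic_on_line[OF K, of z "Inl j" 0] z by (intro DERIV_add DERIV_const) simp
  then have "((\<lambda>t. partial_deriv (Inr k) B (z + axis (Inl j) t) / B (z + axis (Inl j) t)) has_field_derivative
      partial_deriv (Inl j) ?K z) (at 0)"
    unfolding DERIV_cong_ev[OF refl ev refl] by simp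
  then show ?thesis unfolding partial_deriv_def[of "Inl j"] by (simp add: DERIV_imp_deriv)
qed

text \<open>With \<open>R = B / A\<close>, the quotient of \<open>R (vec_join x y)\<close> by
  \<open>R (vec_join w y)\<close> does not depend on \<open>y\<close>: its logarithmic derivative in
  \<open>y\<close> is \<open>K k\<close> at \<open>w\<close> minus \<open>K k\<close> at
  \<open>x\<close>, and \<open>K k\<close> does not depend on the left half.\<close>

lemma mixed_log_derivative_eq_imp:
  fixes A B :: "complex ^ ('n::finite + 'n) \<Rightarrow> complex"
  assumes A: "osgood_holomorphic_on A \<Omega>" and B: "osgood_holomorphic_on B \<Omega>"
    and \<Omega>: "\<Omega> = polydisc (vec_join p (vec_cnj p)) r"
    and nzA: "\<And>z. z \<in> \<Omega> \<Longrightarrow> A z \<noteq> 0" and nzB: "\<And>z. z \<in> \<Omega> \<Longrightarrow> B z \<noteq> 0"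
    and eq: "\<And>x j k. x \<in> polydisc p r \<Longrightarrow>
      partial_deriv (Inl j) (\<lambda>z. partial_deriv (Inr k) A z / A z) (vec_join x (vec_cnj x)) =
      partial_deriv (Inl j) (\<lambda>z. partial_deriv (Inr k) B z / B z) (vec_join x (vec_cnj x))"
    and x: "x \<in> polydisc p r" and w: "w \<in> polydisc p r"
    and y: "y \<in> polydisc (vec_cnj p) r" and y': "y' \<in> polydisc (vec_cnj p) r"
  shows "B (vec_join x y) * A (vec_join w y) / (A (vec_join x y) * B (vec_join w y)) =
    B (vec_join x y') * A (vec_join w y') / (A (vec_join x y') * B (vec_join w y'))"
proof -
  have "open \<Omega>" unfolding \<Omega> by (rule open_polydisc)
  define K where "K k z = partial_deriv (Inr k) A z / A z - partial_deriv (Inr k) B z / B z" for k z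
  have KA: "osgood_holomorphic_on (\<lambda>z. partial_deriv (Inr k) A z / A z) \<Omega>"
    and KB: "osgood_holomorphic_on (\<lambda>z. partial_deriv (Inr k) B z / B z) \<Omega>" for k
    by (intro osgood_holomorphic_on_divide osgood_holomorphic_on_partial_deriv A B nzA nzB \<open>open \<Omega>\<close>; assumption)+
  \<comment> \<open>Polarization carries the hypothesis \<open>eq\<close> from the mirror set to all
    of \<open>\<Omega>\<close>.\<close>
  have D0: "partial_deriv (Inl j) (\<lambda>z. partial_deriv (Inr k) A z / A z) z -
      partial_deriv (Inl j) (\<lambda>z. partial_deriv (Inr k) B z / B z) z = 0" if "z \<in> \<Omega>" for j k z
    by (rule polarization_polydisc[OF _ \<Omega> _ that])
       (intro osgood_holomorphic_on_diff osgood_holomorphic_on_partial_deriv KA KB \<open>open \<Omega>\<close>, simp add: eq)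
  have Kconst: "K k (vec_join a b) = K k (vec_join a' b)"
    if "a \<in> polydisc p r" "a' \<in> polydisc p r" "b \<in> polydisc (vec_cnj p) r" for k a a' b
  proof (rule constant_on_polydisc[of p r "\<lambda>a. K k (vec_join a b)", OF _ that(1,2)])
    fix a j assume a: "a \<in> polydisc p r"
    have "vec_join a b \<in> \<Omega>" using a that(3) by (simp add: \<Omega>)
    then show "((\<lambda>t. K k (vec_join (a + axis j t) b)) has_field_derivative 0) (at 0)"
      using DERIV_diff[OF osgood_holomorphic_on_line[OF KA, of "vec_join a b" "Inl j" 0 k]
            osgood_holomorphic_on_line[OF KB, of "vec_join a b" "Inl j" 0 k]] D0
      by (simp add: K_def vec_join_add_axis)
  qed
  show ?thesis
  proof (rule constant_on_polydisc[of "vec_cnj p" r "\<lambda>y. B (vec_join x y) * A (vec_join w y) /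
        (A (vec_join x y) * B (vec_join w y))", OF _ y y'])
    fix b k assume b: "b \<in> polydisc (vec_cnj p) r"
    have in\<Omega>: "vec_join x b \<in> \<Omega>" "vec_join w b \<in> \<Omega>" using x w b by (simp_all add: \<Omega>)
    have der: "((\<lambda>t. H (vec_join a (b + axis k t))) has_field_derivative partial_deriv (Inr k) H (vec_join a b)) (at 0)"
      if "osgood_holomorphic_on H \<Omega>" "vec_join a b \<in> \<Omega>" for H a
      using osgood_holomorphic_on_line[OF that(1), of "vec_join a b" "Inr k" 0] that(2)
      by (simp add: vec_join_add_axis)
    have nz: "A (vec_join x b) \<noteq> 0" "A (vec_join w b) \<noteq> 0" "B (vec_join x b) \<noteq> 0" "B (vec_join w b) \<noteq> 0"
      using nzA nzB in\<Omega> by auto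
    note d = der[OF A in\<Omega>(1)] der[OF A in\<Omega>(2)] der[OF B in\<Omega>(1)] der[OF B in\<Omega>(2)]
    have K: "K k (vec_join x b) = K k (vec_join w b)" by (rule Kconst[OF x w b])
    define a1 a2 b1 b2 a1' a2' b1' b2' where defs:
      "a1 = A (vec_join x b)" "a2 = A (vec_join w b)" "b1 = B (vec_join x b)" "b2 = B (vec_join w b)"
      "a1' = partial_deriv (Inr k) A (vec_join x b)" "a2' = partial_deriv (Inr k) A (vec_join w b)"
      "b1' = partial_deriv (Inr k) B (vec_join x b)" "b2' = partial_deriv (Inr k) B (vec_join w b)"
    \<comment> \<open>The numerator produced by the quotient rule, factored into the four values
      times the sum of logarithmic derivatives.\<close>
    have "((b1' * a2 + a2' * b1) * (a1 * b2) - b1 * a2 * (a1' * b2 + b2' * a1)) =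
        a1 * a2 * b1 * b2 * (b1' / b1 + a2' / a2 - a1' / a1 - b2' / b2)"
      using nz by (simp add: defs[symmetric] field_simps)
    also have "b1' / b1 + a2' / a2 - a1' / a1 - b2' / b2 = 0"
      using K by (simp add: K_def defs algebra_simps)
    finally have "((b1' * a2 + a2' * b1) * (a1 * b2) - b1 * a2 * (a1' * b2 + b2' * a1)) /
        ((a1 * b2) * (a1 * b2)) = 0" by simp
    then show "((\<lambda>t. B (vec_join x (b + axis k t)) * A (vec_join w (b + axis k t)) /
        (A (vec_join x (b + axis k t)) * B (vec_join w (b + axis k t)))) has_field_derivative 0) (at 0)"
      using DERIV_divide[OF DERIV_mult[OF d(3) d(2)] DERIV_mult[OF d(1) d(4)]] nz
      by (simp add: defs)
  qed
qed

subsection \<open>The equivalence\<close>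

text \<open>The hypothesis \<open>eq\<close> is condition (iv) without denominators. Polarized, it
  gives a rescaling by \<open>h\<close> on an open \<open>V\<close>; the rescaling is then extended
  to a function \<open>g\<close> with one argument free, then with the other, then with
  both.\<close>

lemma rescaling_on_somewhere_dense_imp:
  fixes L M :: "complex ^ 'n \<Rightarrow> complex ^ 'n \<Rightarrow> complex"
  assumes X: "open X" "connected X"
    and L: "sesqui_holomorphic_on L X" "nondegenerate_on L X"
    and M: "sesqui_holomorphic_on M X" "nondegenerate_on M X"
    and w: "w \<in> X" and z: "z \<in> X" "0 < M z z / L z z"
    and S: "S \<subseteq> X" "somewhere_dense S"
    and eq: "\<And>x. x \<in> S \<Longrightarrow>
      of_real ((cmod (L x w))\<^sup>2) * (M x x * M w w) = of_real ((cmod (M x w))\<^sup>2) * (L x x * L w w)"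
  shows "hermitean_rescalings_on L M X"
proof -
  have nd: "L x x \<noteq> 0" "M x x \<noteq> 0" if "x \<in> X" for x
    using L(2) M(2) that unfolding nondegenerate_on_def diagonal_def by auto
  define F where "F x y = L x w * cnj (L y w) * (M x y * M w w) - M x w * cnj (M y w) * (L x y * L w w)" for x y
  have "sesqui_holomorphic_on F X"
    unfolding F_def
    by (intro sesqui_holomorphic_on_diff sesqui_holomorphic_on_mult sesqui_holomorphic_on_fst
        sesqui_holomorphic_on_cnj_snd sesqui_holomorphic_on_const L M
        sesqui_holomorphic_on_holomorphic[OF L(1) w] sesqui_holomorphic_on_holomorphic[OF M(1) w])
  moreover have "F x x = 0" if "x \<in> S" for x
    using eq[OF that] unfolding F_def complex_norm_square by simp
  ultimately have "F x y = 0" if "x \<in> X" "y \<in> X" for x y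
    using sesqui_holomorphic_polarization[OF X _ S _ that] by blast
  then have base: "L x w * cnj (L y w) * (M x y * M w w) = M x w * cnj (M y w) * (L x y * L w w)"
    if "x \<in> X" "y \<in> X" for x y using that unfolding F_def by simp
  define c where "c = L w w / M w w"
  define h where "h v = M v w / L v w" for v
  define V where "V = {v \<in> X. L v w * M v w \<noteq> 0}"
  have c: "c \<noteq> 0" using nd[OF w] by (simp add: c_def)
  have V: "V \<subseteq> X" "w \<in> V" using w nd by (auto simp: V_def)
  then have "V \<noteq> {}" by blast
  have "open V"
  proof -
    have "continuous_on X (\<lambda>v. L v w * M v w)"
      by (intro holomorphic_several_on_imp_continuous_on holomorphic_several_on_mult
          sesqui_holomorphic_on_holomorphic[OF L(1) w] sesqui_holomorphic_on_holomorphic[OF M(1) w])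
    then have "open (X \<inter> (\<lambda>v. L v w * M v w) -` (- {0}))"
      by (rule continuous_open_preimage[OF _ X(1) open_Compl[OF closed_singleton]])
    then show ?thesis by (simp add: V_def vimage_def Int_def)
  qed
  have h: "h v \<noteq> 0" if "v \<in> V" for v using that by (simp add: h_def V_def)
  have on_V: "M x y = c * h x * cnj (h y) * L x y" if "x \<in> V" "y \<in> V" for x y
    using base[of x y] that V nd[OF w] by (simp add: V_def c_def h_def field_simps)
  \<comment> \<open>As a function of \<open>v\<close>, the product
    \<open>L v x * cnj (L x v)\<close> is holomorphic and non-zero at \<open>v = x\<close>, so it
    cannot vanish on all of \<open>V\<close>.\<close>
  have pick: "\<exists>v\<in>V. L v x \<noteq> 0 \<and> L x v \<noteq> 0" if "x \<in> X" for x
  proof -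
    have "holomorphic_several_on (\<lambda>v. L v x * cnj (L x v)) X"
      by (intro holomorphic_several_on_mult sesqui_holomorphic_on_holomorphic[OF L(1) that]
          sesqui_holomorphic_on_cnj[OF L(1) that])
    from holomorphic_several_nonzero_in_open[OF X this \<open>open V\<close> \<open>V \<noteq> {}\<close> V(1) that]
    show ?thesis using nd[OF that] by fastforce
  qed
  define u where "u x = (SOME v. v \<in> V \<and> L v x \<noteq> 0 \<and> L x v \<noteq> 0)" for x
  have u: "u x \<in> V" "L (u x) x \<noteq> 0" "L x (u x) \<noteq> 0" if "x \<in> X" for x
    using someI_ex[of "\<lambda>v. v \<in> V \<and> L v x \<noteq> 0 \<and> L x v \<noteq> 0"] pick[OF that] unfolding u_def by blast+
  \<comment> \<open>Solved from the desired identity at the pair of \<open>x\<close> and its base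
    point \<open>u x\<close>.\<close>
  define g where "g x = M x (u x) / (c * cnj (h (u x)) * L x (u x))" for x
  have right_V: "M x v = c * g x * cnj (h v) * L x v" if x: "x \<in> X" and v: "v \<in> V" for x v
  proof -
    have "u x \<in> X" "v \<in> X" using u(1)[OF x] V v by auto
    \<comment> \<open>The desired identity cross-multiplied, so that it is holomorphic in the first
      argument; on \<open>V\<close> it follows from \<open>on_V\<close>.\<close>
    have "M x v * (cnj (h (u x)) * L x (u x)) - M x (u x) * (cnj (h v) * L x v) = 0"
    proof (rule holomorphic_several_eq_0[where f = "\<lambda>y. M y v * (cnj (h (u x)) * L y (u x)) - M y (u x) * (cnj (h v) * L y v)",
        OF X _ \<open>open V\<close> \<open>V \<noteq> {}\<close> V(1) _ x])
      show "holomorphic_several_on (\<lambda>y. M y v * (cnj (h (u x)) * L y (u x)) - M y (u x) * (cnj (h v) * L y v)) X"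
        by (intro holomorphic_several_on_diff holomorphic_several_on_mult holomorphic_several_on_const
            sesqui_holomorphic_on_holomorphic[OF L(1)] sesqui_holomorphic_on_holomorphic[OF M(1)]
            \<open>u x \<in> X\<close> \<open>v \<in> X\<close>)
      show "M y v * (cnj (h (u x)) * L y (u x)) - M y (u x) * (cnj (h v) * L y v) = 0" if "y \<in> V" for y
        using on_V[OF that v] on_V[OF that u(1)[OF x]] by simp
    qed
    then show ?thesis using h[OF u(1)[OF x]] u(3)[OF x] c by (simp add: g_def field_simps)
  qed
  \<comment> \<open>This relates \<open>M x y\<close> to \<open>M y x\<close> while \<open>c\<close>
    is not yet known to be real, hence both \<open>c\<close> and \<open>cnj c\<close>.\<close>
  have swap: "M x y * cnj (L y x) * cnj c - c * (cnj (M y x) * L x y) = 0" if "x \<in> X" "y \<in> X" for x y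
  proof (rule sesqui_holomorphic_eq_0[where F = "\<lambda>x y. M x y * cnj (L y x) * cnj c - c * (cnj (M y x) * L x y)",
        OF X _ \<open>open V\<close> \<open>V \<noteq> {}\<close> V(1) _ that])
    show "sesqui_holomorphic_on (\<lambda>x y. M x y * cnj (L y x) * cnj c - c * (cnj (M y x) * L x y)) X"
      by (intro sesqui_holomorphic_on_diff sesqui_holomorphic_on_mult sesqui_holomorphic_on_const
          sesqui_holomorphic_on_cnj_swap L M)
    show "M x y * cnj (L y x) * cnj c - c * (cnj (M y x) * L x y) = 0" if "x \<in> V" "y \<in> V" for x y
      using on_V[OF that] on_V[OF that(2,1)] by simp
  qed
  have left_V: "M v x = c * h v * cnj (g x) * L v x" if x: "x \<in> X" and v: "v \<in> V" for x v
  proof -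
    \<comment> \<open>Conjugating \<open>right_V\<close> and applying \<open>swap\<close> gives the
      claim only where \<open>L x v\<close> is non-zero; the identity theorem in \<open>v\<close>
      then removes this restriction. Multiplying by \<open>L v w\<close> clears the denominator of
      \<open>h\<close>.\<close>
    have "\<exists>V'. open V' \<and> V' \<noteq> {} \<and> V' \<subseteq> V \<and> (\<forall>v\<in>V'. cnj (L x v) \<noteq> 0)"
      by (rule holomorphic_several_nonzero_in_open[OF X sesqui_holomorphic_on_cnj[OF L(1) x]
            \<open>open V\<close> \<open>V \<noteq> {}\<close> V(1) x]) (use nd x in simp)
    then obtain V' where V': "open V'" "V' \<noteq> {}" "V' \<subseteq> V" and nzV': "\<And>v. v \<in> V' \<Longrightarrow> L x v \<noteq> 0"
      by auto
    have "v \<in> X" using v V by blast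
    have "M v x * L v w - c * cnj (g x) * (M v w * L v x) = 0"
    proof (rule holomorphic_several_eq_0[where f = "\<lambda>v. M v x * L v w - c * cnj (g x) * (M v w * L v x)",
        OF X _ V'(1,2) subset_trans[OF V'(3) V(1)] _ \<open>v \<in> X\<close>])
      show "holomorphic_several_on (\<lambda>v. M v x * L v w - c * cnj (g x) * (M v w * L v x)) X"
        by (intro holomorphic_several_on_diff holomorphic_several_on_mult holomorphic_several_on_const
            sesqui_holomorphic_on_holomorphic[OF L(1)] sesqui_holomorphic_on_holomorphic[OF M(1)] x w)
      fix v assume "v \<in> V'"
      then have v: "v \<in> V" "v \<in> X" "L v w \<noteq> 0" and nz: "L x v \<noteq> 0" using V' V nzV' by (auto simp: V_def)
      have "cnj (M x v) = cnj c * cnj (g x) * h v * cnj (L x v)"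
        using right_V[OF x v(1)] by simp
      then have "M v x * (cnj (L x v) * cnj c) = (c * cnj (g x) * h v * L v x) * (cnj (L x v) * cnj c)"
        using swap[OF v(2) x] by (simp add: algebra_simps)
      then have "M v x = c * cnj (g x) * h v * L v x" using nz c by simp
      then show "M v x * L v w - c * cnj (g x) * (M v w * L v x) = 0"
        using v(3) by (simp add: h_def)
    qed
    then show ?thesis using v by (simp add: h_def V_def field_simps)
  qed
  have rescale: "M x y = c * g x * cnj (g y) * L x y" if x: "x \<in> X" and y: "y \<in> X" for x y
  proof -
    \<comment> \<open>A base point with \<open>L v y\<close> non-zero. The identity comparing
      \<open>M x y\<close> with \<open>M v y\<close> continues from \<open>y \<in> V\<close> to all
      of \<open>X\<close>, and \<open>left_V\<close> then evaluates \<open>M v y\<close>.\<close>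
    define v where "v = u y"
    have v: "v \<in> V" "v \<in> X" "L v y \<noteq> 0" using u[OF y] V by (auto simp: v_def)
    have "cnj (M x y) * cnj (h v) * cnj (L v y) - cnj (M v y) * cnj (g x) * cnj (L x y) = 0"
    proof (rule holomorphic_several_eq_0[where f = "\<lambda>y. cnj (M x y) * cnj (h v) * cnj (L v y) - cnj (M v y) * cnj (g x) * cnj (L x y)",
        OF X _ \<open>open V\<close> \<open>V \<noteq> {}\<close> V(1) _ y])
      show "holomorphic_several_on (\<lambda>y. cnj (M x y) * cnj (h v) * cnj (L v y) - cnj (M v y) * cnj (g x) * cnj (L x y)) X"
        by (intro holomorphic_several_on_diff holomorphic_several_on_mult holomorphic_several_on_const
            sesqui_holomorphic_on_cnj[OF L(1)] sesqui_holomorphic_on_cnj[OF M(1)] x v)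
      show "cnj (M x y) * cnj (h v) * cnj (L v y) - cnj (M v y) * cnj (g x) * cnj (L x y) = 0" if "y \<in> V" for y
        using right_V[OF x that] on_V[OF v(1) that] by simp
    qed
    then have "cnj (M x y * h v * L v y) = cnj (M v y * g x * L x y)" by simp
    then have "M x y * h v * L v y = M v y * g x * L x y" by (simp only: complex_cnj_cancel_iff)
    then have "M x y * (h v * L v y) = (c * g x * cnj (g y) * L x y) * (h v * L v y)"
      unfolding left_V[OF y v(1)] by (simp add: algebra_simps)
    then show ?thesis using h[OF v(1)] v(3) by simp
  qed
  have g: "g x \<noteq> 0" if "x \<in> X" for x using rescale[OF that that] nd[OF that] by auto
  have "M z z / L z z = c * of_real ((cmod (g z))\<^sup>2)"
    using rescale[OF z(1) z(1)] nd[OF z(1)] unfolding complex_norm_square by simp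
  then have "c = (M z z / L z z) / of_real ((cmod (g z))\<^sup>2)" using g[OF z(1)] by simp
  then have "Im c = Im (M z z / L z z) / (cmod (g z))\<^sup>2" "Re c = Re (M z z / L z z) / (cmod (g z))\<^sup>2"
    by (simp_all only: Im_divide_of_real Re_divide_of_real)
  then have cR: "Im c = 0" "Re c > 0"
    using z(2) g[OF z(1)] by (simp_all add: less_complex_def)
  \<comment> \<open>The point \<open>z\<close> shows that \<open>c\<close> is positive, so its
    square root can be absorbed into the rescaling.\<close>
  define f where "f x = of_real (sqrt (Re c)) * g x" for x
  have c_eq: "c = of_real (sqrt (Re c)) * of_real (sqrt (Re c))"
    using cR by (simp add: complex_eq_iff flip: of_real_mult)
  show ?thesis
    unfolding hermitean_rescalings_on_def
  proof (intro exI[of _ f] conjI ballI)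
    fix x y assume "x \<in> X" "y \<in> X"
    then have "M x y = of_real (sqrt (Re c)) * of_real (sqrt (Re c)) * g x * cnj (g y) * L x y"
      using rescale c_eq by metis
    then show "M x y = f x * cnj (f y) * L x y" by (simp add: f_def)
  qed (use g cR in \<open>auto simp: f_def\<close>)
qed

lemma hermitean_rescalings_onE:
  assumes "hermitean_rescalings_on L M Y"
  obtains f where "\<And>x. x \<in> Y \<Longrightarrow> f x \<noteq> 0"
    "\<And>x y. x \<in> Y \<Longrightarrow> y \<in> Y \<Longrightarrow> M x y = f x * cnj (f y) * L x y"
  using assms unfolding hermitean_rescalings_on_def by metis

lemma positive_complex_norm_square: "z \<noteq> 0 \<Longrightarrow> 0 < z * cnj z"
  by (simp add: less_complex_def complex_mult_cnj sum_power2_gt_zero_iff complex_eq_iff)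

lemma somewhere_dense_open: "open U \<Longrightarrow> U \<noteq> {} \<Longrightarrow> somewhere_dense U"
  unfolding somewhere_dense_def
  by (metis closure_subset interior_maximal subset_empty)

theorem theorem5p7:
  fixes X :: "(complex ^ 'n) set"
    and L M :: "complex ^ 'n \<Rightarrow> complex ^ 'n \<Rightarrow> complex"
  assumes "open X" and "connected X" and "X \<noteq> {}"
    and "sesqui_holomorphic_on L X" and "sesqui_holomorphic_on M X"
    and "nondegenerate_on L X" and "nondegenerate_on M X"
  defines "i \<equiv> hermitean_rescalings_on L M X"
    and "i' \<equiv> (\<exists>Y\<subseteq>X. somewhere_dense Y \<and> hermitean_rescalings_on L M Y)"
    and "ii \<equiv> (\<exists>U f. open U \<and> U \<noteq> {} \<and> U \<subseteq> X \<and>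
           holomorphic_several_on f U \<and> (\<forall>x\<in>U. f x \<noteq> 0) \<and>
           (\<forall>x\<in>U. diagonal M x = of_real ((cmod (f x))\<^sup>2) * diagonal L x))"
    and "iii \<equiv>
           (\<exists>U. open U \<and> U \<noteq> {} \<and> U \<subseteq> X \<and>
              (\<forall>x\<in>U. \<exists>l m. log_branch_near x (diagonal L) l \<and> log_branch_near x (diagonal M) m \<and>
                 (\<forall>j k. wirtinger j (wirtinger_bar k l) x = wirtinger j (wirtinger_bar k m) x))) \<and>
           (\<exists>S\<subseteq>X. somewhere_dense S \<and> (\<forall>x\<in>S. 0 < diagonal M x / diagonal L x))"
    and "iv \<equiv> (\<exists>y\<in>X. \<exists>z\<in>X. \<exists>U\<subseteq>X. somewhere_dense U \<and> 0 < M z z / L z z \<and>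
           (\<forall>x\<in>U. of_real ((cmod (L x y))\<^sup>2) / (L x x * L y y) =
                  of_real ((cmod (M x y))\<^sup>2) / (M x x * M y y)))"
  shows "(i \<longleftrightarrow> i') \<and> (i \<longleftrightarrow> ii) \<and> (i \<longleftrightarrow> iii) \<and> (i \<longleftrightarrow> iv)"
proof -
  note X = assms(1,2)
  note L = assms(4,6) and M = assms(5,7)
  have nd: "L x x \<noteq> 0" "M x x \<noteq> 0" if "x \<in> X" for x
    using assms(6,7) that unfolding nondegenerate_on_def diagonal_def by auto
  have "somewhere_dense X" using somewhere_dense_open[OF assms(1,3)] .
  have "i'" if "i"
    using that \<open>somewhere_dense X\<close> unfolding i_def i'_def by blast
  moreover have "iv" if hyp: "i'"
  proof -
    obtain Y where Y: "Y \<subseteq> X" "somewhere_dense Y" and Y': "hermitean_rescalings_on L M Y"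
      using hyp unfolding i'_def by blast
    obtain f where f: "\<And>x. x \<in> Y \<Longrightarrow> f x \<noteq> 0"
      and resc: "\<And>x y. x \<in> Y \<Longrightarrow> y \<in> Y \<Longrightarrow> M x y = f x * cnj (f y) * L x y"
      using Y' by (rule hermitean_rescalings_onE) (rule that)
    \<comment> \<open>A single point of \<open>Y\<close> serves as both \<open>y\<close> and
      \<open>z\<close> in (iv).\<close>
    obtain w where w: "w \<in> Y" using Y(2) unfolding somewhere_dense_def by fastforce
    have "M w w / L w w = f w * cnj (f w)"
      using resc[OF w w] nd w Y(1) by (simp add: subset_iff)
    then have "0 < M w w / L w w" using positive_complex_norm_square[OF f[OF w]] by simp
    moreover have "of_real ((cmod (L x w))\<^sup>2) / (L x x * L w w) =
        of_real ((cmod (M x w))\<^sup>2) / (M x x * M w w)" if x: "x \<in> Y" for x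
    proof -
      have nz: "L x x * L w w \<noteq> 0" "M x x * M w w \<noteq> 0" using nd x w Y(1) by auto
      show ?thesis
        unfolding complex_norm_square frac_eq_eq[OF nz]
        by (simp add: resc[OF x w] resc[OF x x] resc[OF w w] algebra_simps)
    qed
    ultimately show ?thesis unfolding iv_def using w Y by blast
  qed
  moreover have "i" if hyp: "iv"
  proof -
    obtain y z U where yz: "y \<in> X" "z \<in> X" "0 < M z z / L z z" and U: "U \<subseteq> X" "somewhere_dense U"
      and eq: "\<And>x. x \<in> U \<Longrightarrow> of_real ((cmod (L x y))\<^sup>2) / (L x x * L y y) =
                  of_real ((cmod (M x y))\<^sup>2) / (M x x * M y y)"
      using hyp unfolding iv_def by blast
    have "of_real ((cmod (L x y))\<^sup>2) * (M x x * M y y) = of_real ((cmod (M x y))\<^sup>2) * (L x x * L y y)"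
      if "x \<in> U" for x
    proof -
      have nz: "L x x * L y y \<noteq> 0" "M x x * M y y \<noteq> 0" using nd U(1) yz(1) that by auto
      show ?thesis using eq[OF that] unfolding frac_eq_eq[OF nz] .
    qed
    then show ?thesis
      unfolding i_def by (rule rescaling_on_somewhere_dense_imp[OF X L M yz U])
  qed
  moreover have "ii" if hyp: "i"
  proof -
    obtain f where f: "\<And>x. x \<in> X \<Longrightarrow> f x \<noteq> 0"
      and resc: "\<And>x y. x \<in> X \<Longrightarrow> y \<in> X \<Longrightarrow> M x y = f x * cnj (f y) * L x y"
      using hyp[unfolded i_def] by (rule hermitean_rescalings_onE) (rule that)
    obtain w where w: "w \<in> X" using assms(3) by blast
    obtain U where U: "open U" "U \<noteq> {}" "U \<subseteq> X" and nzU: "\<And>x. x \<in> U \<Longrightarrow> L x w \<noteq> 0"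
      using holomorphic_several_nonzero_in_open[OF X sesqui_holomorphic_on_holomorphic[OF L(1) w]
          assms(1,3) order_refl w nd(1)[OF w]] by blast
    \<comment> \<open>The function \<open>f\<close> comes without regularity, but where
      \<open>L x w\<close> is non-zero it equals this quotient of holomorphic functions.\<close>
    have "holomorphic_several_on (\<lambda>x. M x w * inverse (cnj (f w) * L x w)) U"
      using nzU f[OF w]
      by (intro holomorphic_several_on_mult holomorphic_several_on_inverse holomorphic_several_on_const
          holomorphic_several_on_subset[OF sesqui_holomorphic_on_holomorphic[OF L(1) w] U(3)]
          holomorphic_several_on_subset[OF sesqui_holomorphic_on_holomorphic[OF M(1) w] U(3)]) auto
    then have "holomorphic_several_on f U"
      by (rule holomorphic_several_on_cong[OF _ U(1)])
         (use resc w U(3) nzU f[OF w] in \<open>auto simp: subset_iff field_simps\<close>)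
    moreover have "diagonal M x = of_real ((cmod (f x))\<^sup>2) * diagonal L x" if "x \<in> U" for x
      using resc[of x x] that U(3) unfolding diagonal_def complex_norm_square by auto
    ultimately show ?thesis unfolding ii_def using U f by blast
  qed
  moreover have "i'" if hyp: "ii"
  proof -
    obtain U f where U: "open U" "U \<noteq> {}" "U \<subseteq> X" and f: "holomorphic_several_on f U" "\<And>x. x \<in> U \<Longrightarrow> f x \<noteq> 0"
      and diag: "\<And>x. x \<in> U \<Longrightarrow> diagonal M x = of_real ((cmod (f x))\<^sup>2) * diagonal L x"
      using hyp unfolding ii_def by blast
    \<comment> \<open>Polarization needs a connected set, and \<open>U\<close> need not be
      connected.\<close>
    obtain a e where B: "e > 0" "ball a e \<subseteq> U" using U(1,2) openE by (metis all_not_in_conv)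
    have F: "sesqui_holomorphic_on (\<lambda>x y. M x y - f x * cnj (f y) * L x y) (ball a e)"
      using B(2) U(3)
      by (intro sesqui_holomorphic_on_diff sesqui_holomorphic_on_mult sesqui_holomorphic_on_fst
          sesqui_holomorphic_on_cnj_snd holomorphic_several_on_subset[OF f(1)]
          sesqui_holomorphic_on_subset[OF L(1)] sesqui_holomorphic_on_subset[OF M(1)]) auto
    have sd: "somewhere_dense (ball a e)" by (rule somewhere_dense_open) (use B in auto)
    have "M x y - f x * cnj (f y) * L x y = 0" if "x \<in> ball a e" "y \<in> ball a e" for x y
      by (rule sesqui_holomorphic_polarization[OF open_ball connected_ball F order_refl sd _ that])
         (use diag[unfolded diagonal_def complex_norm_square] B(2) in auto)
    then show ?thesis
      unfolding i'_def hermitean_rescalings_on_def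
      using sd B(2) U(3) f(2)
      by (intro exI[of _ "ball a e"] conjI exI[of _ f]) auto
  qed
  moreover have "iii" if hyp: "i"
  proof -
    obtain f where f: "\<And>x. x \<in> X \<Longrightarrow> f x \<noteq> 0"
      and resc: "\<And>x y. x \<in> X \<Longrightarrow> y \<in> X \<Longrightarrow> M x y = f x * cnj (f y) * L x y"
      using hyp[unfolded i_def] by (rule hermitean_rescalings_onE) (rule that)
    have pos: "0 < diagonal M x / diagonal L x" if "x \<in> X" for x
      using resc[OF that that] positive_complex_norm_square[OF f[OF that]] nd[OF that]
      by (simp add: diagonal_def)
    obtain p r where r: "r > 0" "polydisc p r \<subseteq> X"
      and G: "osgood_holomorphic_on (holomorphic_form L) (polydisc (vec_join p (vec_cnj p)) r)"
        "osgood_holomorphic_on (holomorphic_form M) (polydisc (vec_join p (vec_cnj p)) r)"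
      and nz: "\<And>z. z \<in> polydisc (vec_join p (vec_cnj p)) r \<Longrightarrow> holomorphic_form L z \<noteq> 0"
        "\<And>z. z \<in> polydisc (vec_join p (vec_cnj p)) r \<Longrightarrow> holomorphic_form M z \<noteq> 0"
      using sesqui_holomorphic_local_pair[OF L M assms(1,3) order_refl] by metis
    let ?\<Omega> = "polydisc (vec_join p (vec_cnj p)) r"
    have diag: "diagonal F x = holomorphic_form F (vec_join x (vec_cnj x))" for F and x :: "complex ^ 'n"
      by (simp add: diagonal_def holomorphic_form_def)
    have branch: "\<exists>l. log_branch_near x (diagonal F) l"
      if "osgood_holomorphic_on (holomorphic_form F) ?\<Omega>" "\<And>z. z \<in> ?\<Omega> \<Longrightarrow> holomorphic_form F z \<noteq> 0"
        and x: "x \<in> polydisc p r" for F x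
    proof (rule log_branch_near_exists[OF open_polydisc x])
      have contF: "continuous_on ?\<Omega> (holomorphic_form F)"
        using that(1) unfolding osgood_holomorphic_on_def by blast
      have "continuous_on (polydisc p r) (\<lambda>x. vec_join x (vec_cnj x))"
        by (intro continuous_intros)
      then show "continuous_on (polydisc p r) (diagonal F)"
        unfolding diag[abs_def] by (rule continuous_on_compose2[OF contF]) auto
      show "diagonal F x \<noteq> 0" using that(2) x by (simp add: diag)
    qed
    have "\<exists>l m. log_branch_near x (diagonal L) l \<and> log_branch_near x (diagonal M) m \<and>
        (\<forall>j k. wirtinger j (wirtinger_bar k l) x = wirtinger j (wirtinger_bar k m) x)"
      if x: "x \<in> polydisc p r" for x
    proof -
      obtain l m where lm: "log_branch_near x (diagonal L) l" "log_branch_near x (diagonal M) m"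
        using branch[OF G(1) nz(1) x] branch[OF G(2) nz(2) x] by blast
      have "wirtinger j (wirtinger_bar k l) x = wirtinger j (wirtinger_bar k m) x" for j k
      proof -
        have "holomorphic_form M z = f (vec_left z) * cnj (f (vec_cnj (vec_right z))) * holomorphic_form L z"
          if "z \<in> ?\<Omega>" for z
          unfolding holomorphic_form_def
          by (rule resc) (use polydisc_vec_leftD[OF that] polydisc_vec_rightD[OF that] r(2) in auto)
        \<comment> \<open>In the joined variables the factor \<open>cnj (f y)\<close> becomes this
          \<open>g\<close>, evaluated at the right half.\<close>
        from mixed_log_derivative_rescaling[where f = f and g = "\<lambda>y. cnj (f (vec_cnj y))",
            OF G open_polydisc nz this]
        have "partial_deriv (Inl j) (\<lambda>z. partial_deriv (Inr k) (holomorphic_form M) z / holomorphic_form M z)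
            (vec_join x (vec_cnj x)) =
          partial_deriv (Inl j) (\<lambda>z. partial_deriv (Inr k) (holomorphic_form L) z / holomorphic_form L z)
            (vec_join x (vec_cnj x))" using x by simp
        then show ?thesis
          using wirtinger_log_branch[OF G(1) refl nz(1) diag x lm(1), of j k]
            wirtinger_log_branch[OF G(2) refl nz(2) diag x lm(2), of j k] by simp
      qed
      then show ?thesis using lm by blast
    qed
    then have "\<exists>U. open U \<and> U \<noteq> {} \<and> U \<subseteq> X \<and>
        (\<forall>x\<in>U. \<exists>l m. log_branch_near x (diagonal L) l \<and> log_branch_near x (diagonal M) m \<and>
          (\<forall>j k. wirtinger j (wirtinger_bar k l) x = wirtinger j (wirtinger_bar k m) x))"
      using open_polydisc[of p r] centre_in_polydisc[OF r(1), of p] r(2)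
      by (intro exI[of _ "polydisc p r"]) auto
    moreover have "\<exists>S\<subseteq>X. somewhere_dense S \<and> (\<forall>x\<in>S. 0 < diagonal M x / diagonal L x)"
      using \<open>somewhere_dense X\<close> pos by blast
    ultimately show ?thesis unfolding iii_def by blast
  qed
  moreover have "iv" if hyp: "iii"
  proof -
    define log_eq where "log_eq x \<longleftrightarrow> (\<exists>l m. log_branch_near x (diagonal L) l \<and> log_branch_near x (diagonal M) m \<and>
        (\<forall>j k. wirtinger j (wirtinger_bar k l) x = wirtinger j (wirtinger_bar k m) x))" for x
    note hyp' = hyp[unfolded iii_def, folded log_eq_def]
    obtain U where U: "open U" "U \<noteq> {}" "U \<subseteq> X" and log: "\<And>x. x \<in> U \<Longrightarrow> log_eq x"
      using hyp'[THEN conjunct1] by blast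
    obtain S where S: "S \<subseteq> X" "somewhere_dense S" and pos: "\<And>x. x \<in> S \<Longrightarrow> 0 < diagonal M x / diagonal L x"
      using hyp'[THEN conjunct2] by blast
    obtain z where z: "z \<in> S" using S(2) unfolding somewhere_dense_def by fastforce
    \<comment> \<open>On \<open>S\<close> the ratio of the diagonals is real; polarizing this gives
      \<open>R y x = cnj (R x y)\<close> for \<open>R = M / L\<close>, here without
      denominators.\<close>
    have swap: "M x y * cnj (L y x) - cnj (M y x) * L x y = 0" if "x \<in> X" "y \<in> X" for x y
    proof (rule sesqui_holomorphic_polarization[where F = "\<lambda>x y. M x y * cnj (L y x) - cnj (M y x) * L x y",
        OF X _ S _ that])
      show "sesqui_holomorphic_on (\<lambda>x y. M x y * cnj (L y x) - cnj (M y x) * L x y) X"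
        by (intro sesqui_holomorphic_on_diff sesqui_holomorphic_on_mult sesqui_holomorphic_on_cnj_swap L M)
      fix x assume x: "x \<in> S"
      define q where "q = M x x / L x x"
      have "M x x = q * L x x" using nd x S(1) by (auto simp: q_def)
      moreover have "cnj q = q"
        using pos[OF x] unfolding diagonal_def q_def[symmetric] by (simp add: less_complex_def complex_eq_iff)
      ultimately show "M x x * cnj (L x x) - cnj (M x x) * L x x = 0" by simp
    qed
    obtain p r where r: "r > 0" "polydisc p r \<subseteq> U"
      and G: "osgood_holomorphic_on (holomorphic_form L) (polydisc (vec_join p (vec_cnj p)) r)"
        "osgood_holomorphic_on (holomorphic_form M) (polydisc (vec_join p (vec_cnj p)) r)"
      and nz: "\<And>z. z \<in> polydisc (vec_join p (vec_cnj p)) r \<Longrightarrow> holomorphic_form L z \<noteq> 0"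
        "\<And>z. z \<in> polydisc (vec_join p (vec_cnj p)) r \<Longrightarrow> holomorphic_form M z \<noteq> 0"
      using sesqui_holomorphic_local_pair[OF L M U] by metis
    have diag: "diagonal F x = holomorphic_form F (vec_join x (vec_cnj x))" for F and x :: "complex ^ 'n"
      by (simp add: diagonal_def holomorphic_form_def)
    have mixed: "partial_deriv (Inl j) (\<lambda>z. partial_deriv (Inr k) (holomorphic_form L) z / holomorphic_form L z)
          (vec_join x (vec_cnj x)) =
        partial_deriv (Inl j) (\<lambda>z. partial_deriv (Inr k) (holomorphic_form M) z / holomorphic_form M z)
          (vec_join x (vec_cnj x))" if x: "x \<in> polydisc p r" for x j k
    proof -
      obtain l m where lm: "log_branch_near x (diagonal L) l" "log_branch_near x (diagonal M) m"
        and "wirtinger j (wirtinger_bar k l) x = wirtinger j (wirtinger_bar k m) x"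
        using log[of x] x r(2) unfolding log_eq_def by blast
      then show ?thesis
        using wirtinger_log_branch[OF G(1) refl nz(1) diag x lm(1)]
          wirtinger_log_branch[OF G(2) refl nz(2) diag x lm(2)] by simp
    qed
    have nzLM: "L x y \<noteq> 0" "M x y \<noteq> 0" if "x \<in> polydisc p r" "y \<in> polydisc p r" for x y
      using nz[of "vec_join x (vec_cnj y)"] that by (auto simp: holomorphic_form_def)
    have eq: "of_real ((cmod (L x p))\<^sup>2) / (L x x * L p p) = of_real ((cmod (M x p))\<^sup>2) / (M x x * M p p)"
      if x: "x \<in> polydisc p r" for x
    proof -
      have p: "p \<in> polydisc p r" using r(1) by (rule centre_in_polydisc)
      \<comment> \<open>The second argument is compared at \<open>x\<close> and at \<open>p\<close>:
        \<open>R x x / R p x = R x p / R p p\<close> with \<open>R = M / L\<close>.\<close>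
      have ratio: "M x x * L p x / (L x x * M p x) = M x p * L p p / (L x p * M p p)"
        using mixed_log_derivative_eq_imp[OF G refl nz mixed x p, of "vec_cnj x" "vec_cnj p"] x p
        by (simp add: holomorphic_form_def)
      have "x \<in> X" "p \<in> X" using x p r(2) U(3) by auto
      have "M x p * cnj (L p x) = cnj (M p x) * L x p" using swap[OF \<open>x \<in> X\<close> \<open>p \<in> X\<close>] by simp
      from arg_cong[OF this, of cnj] have "cnj (M x p) * L p x = M p x * cnj (L x p)" by simp
      moreover have "M x x * L p x * (L x p * M p p) = M x p * L p p * (L x x * M p x)"
        using ratio nzLM x p by (simp add: frac_eq_eq)
      \<comment> \<open>Both sides carry the common factor \<open>L p x * M p x\<close>, non-zero on
        the polydisc, so that the two relations combine without division.\<close>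
      ultimately have "(L p x * M p x) * (L x p * cnj (L x p) * (M x x * M p p)) =
          (L p x * M p x) * (M x p * cnj (M x p) * (L x x * L p p))"
        by algebra
      then have "L x p * cnj (L x p) * (M x x * M p p) = M x p * cnj (M x p) * (L x x * L p p)"
        using nzLM x p by simp
      moreover have nz': "L x x * L p p \<noteq> 0" "M x x * M p p \<noteq> 0" using nzLM x p by auto
      ultimately show ?thesis unfolding complex_norm_square frac_eq_eq[OF nz'] by simp
    qed
    have "somewhere_dense (polydisc p r)"
      by (rule somewhere_dense_open[OF open_polydisc]) (use centre_in_polydisc[OF r(1), of p] in blast)
    then show ?thesis
      unfolding iv_def
      \<comment> \<open>The positivity point \<open>z\<close> is taken from \<open>S\<close>; (iv)
        does not tie it to the polydisc or to its centre \<open>p\<close>.\<close>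
      using eq pos[OF z] z S(1) r(2) U(3) centre_in_polydisc[OF r(1), of p]
      by (intro bexI[of _ p] bexI[of _ z] exI[of _ "polydisc p r"]) (auto simp: diagonal_def)
  qed
  ultimately show ?thesis by blast
qed

end
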